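(* Let $A\subset\mathbb{R}^d$ be a finite set of sites in general position. The rhomboid bifiltration $\mathrm{Rhomb}=(\mathrm{Rhomb}_{r,k})$ and the multicover bifiltration $\mathrm{Cov}=(\mathrm{Cov}_{r,k})$, indexed by $(r,k)\in[0,\infty)\times\mathbb{N}$, are weakly equivalent.
   Context: $\mathbb{N}=\{1,2,\dots\}$. Bifiltrations are indexed by $[0,\infty)\times\mathbb{N}$ with $(r,k)\le(r',k')$ iff $r\le r'$ and $k\ge k'$, consisting of spaces $X_{r,k}$ with $X_{r,k}\subseteq X_{r',k'}$ for $(r,k)\le(r',k')$. A morphism is a family of continuous maps commuting with the inclusions; it is an objectwise homotopy equivalence if each component is a homotopy equivalence; two bifiltrations are weakly equivalent if connected by a finite zigzag of objectwise homotopy equivalences. $\mathrm{Cov}_{r,k}=\{b\in\mathbb{R}^d: \|b-a\|\le r \text{ for at least } k \text{ points } a\in A\}$. A $(d-1)$-sphere $S\subset\mathbb{R}^d$ partitions $A=A_{in}\sqcup A_{on}\sqcup A_{out}$ (sites inside, on, outside $S$). The combinatorial rhomboid of $S$ is $\rho_S=\{A_{in}\cup Q: Q\subseteq A_{on}\}$; a vertex $v=\{a_1,\dots,a_m\}$ is embedded as $(\sum_i a_i,-m)\in\mathbb{R}^{d+1}$ (depth $m$), and the geometric rhomboid is the convex hull of its embedded vertices. The rhomboid tiling is the polyhedral complex in $\mathbb{R}^{d+1}$ of all rhomboids $\rho_S$, $S$ ranging over all spheres. For a rhomboid $\rho$, $r_\rho$ is the infimum of radii of spheres $S$ with $\rho_S=\rho$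 and $k_\rho$ is the minimum depth among its vertices. $\mathrm{Rhomb}_{r,k}$ is the union of the rhomboids $\rho$ with $r_\rho\le r$ and $k_\rho\ge k$. *)

theory Defs
  imports "HOL-Analysis.Analysis"
begin

text \<open>A bifiltration is a family of topological spaces X r k, (r,k) with r >= 0, k >= 1,
  such that for (r,k) <= (r',k') (i.e. r <= r' and k >= k') the space X r k is a subset
  of X r' k' and the inclusion is continuous.  Values at r < 0 or k = 0 are irrelevant.\<close>

definition is_bifiltration :: "(real \<Rightarrow> nat \<Rightarrow> 'a topology) \<Rightarrow> bool" where
  "is_bifiltration X \<longleftrightarrow>
     (\<forall>r k r' k'. 0 \<le> r \<and> r \<le> r' \<and> 1 \<le> k' \<and> k' \<le> k \<longrightarrow>
        topspace (X r k) \<subseteq> topspace (X r' k') \<and> continuous_map (X r k) (X r' k') id)"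

definition homotopy_equivalence_map :: "'a topology \<Rightarrow> 'b topology \<Rightarrow> ('a \<Rightarrow> 'b) \<Rightarrow> bool" where
  "homotopy_equivalence_map X Y f \<longleftrightarrow>
     continuous_map X Y f \<and>
     (\<exists>g. continuous_map Y X g \<and>
          homotopic_with (\<lambda>h. True) X X (g \<circ> f) id \<and>
          homotopic_with (\<lambda>h. True) Y Y (f \<circ> g) id)"

definition objectwise_he_morphism ::
    "(real \<Rightarrow> nat \<Rightarrow> 'a topology) \<Rightarrow> (real \<Rightarrow> nat \<Rightarrow> 'b topology) \<Rightarrow> (real \<Rightarrow> nat \<Rightarrow> 'a \<Rightarrow> 'b) \<Rightarrow> bool" where
  "objectwise_he_morphism X Y f \<longleftrightarrow>
     (\<forall>r k. 0 \<le> r \<and> 1 \<le> k \<longrightarrow> homotopy_equivalence_map (X r k) (Y r k) (f r k)) \<and>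
     (\<forall>r k r' k'. 0 \<le> r \<and> r \<le> r' \<and> 1 \<le> k' \<and> k' \<le> k \<longrightarrow>
        (\<forall>x\<in>topspace (X r k). f r' k' x = f r k x))"

definition he_linked ::
    "(real \<Rightarrow> nat \<Rightarrow> 'a topology) \<Rightarrow> (real \<Rightarrow> nat \<Rightarrow> 'b topology) \<Rightarrow> bool" where
  "he_linked X Y \<longleftrightarrow>
     (\<exists>f. objectwise_he_morphism X Y f) \<or> (\<exists>g. objectwise_he_morphism Y X g)"

text \<open>Weak equivalence: a finite zigzag of objectwise homotopy equivalences.  The
  intermediate bifiltrations are bifiltrations of (abstract) topological spaces whose points
  are drawn from the type real set (cardinality 2^continuum).\<close>

definition weakly_equivalent ::
    "(real \<Rightarrow> nat \<Rightarrow> 'a topology) \<Rightarrow> (real \<Rightarrow> nat \<Rightarrow> 'b topology) \<Rightarrow> bool" where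
  "weakly_equivalent X Y \<longleftrightarrow>
     is_bifiltration X \<and> is_bifiltration Y \<and>
     (he_linked X Y \<or>
      (\<exists>Zs :: (real \<Rightarrow> nat \<Rightarrow> real set topology) list.
          Zs \<noteq> [] \<and> (\<forall>Z\<in>set Zs. is_bifiltration Z) \<and>
          he_linked X (hd Zs) \<and>
          (\<forall>i. Suc i < length Zs \<longrightarrow> he_linked (Zs ! i) (Zs ! Suc i)) \<and>
          he_linked (last Zs) Y))"

definition general_position :: "'a::euclidean_space set \<Rightarrow> bool" where
  "general_position A \<longleftrightarrow>
     (\<forall>B\<subseteq>A. card B \<le> DIM('a) + 1 \<longrightarrow> \<not> affine_dependent B) \<and>
     (\<forall>z \<rho>. 0 < \<rho> \<longrightarrow> card (A \<inter> sphere z \<rho>) < DIM('a) + 2)"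

definition Cov :: "'a::euclidean_space set \<Rightarrow> real \<Rightarrow> nat \<Rightarrow> 'a set" where
  "Cov A r k = {b. k \<le> card {a\<in>A. dist b a \<le> r}}"

definition Cov_bif :: "'a::euclidean_space set \<Rightarrow> real \<Rightarrow> nat \<Rightarrow> 'a topology" where
  "Cov_bif A r k = subtopology euclidean (Cov A r k)"

definition A_in :: "'a::euclidean_space set \<Rightarrow> 'a \<Rightarrow> real \<Rightarrow> 'a set" where
  "A_in A z \<rho> = {a\<in>A. dist z a < \<rho>}"

definition A_on :: "'a::euclidean_space set \<Rightarrow> 'a \<Rightarrow> real \<Rightarrow> 'a set" where
  "A_on A z \<rho> = {a\<in>A. dist z a = \<rho>}"

definition comb_rhomboid :: "'a::euclidean_space set \<Rightarrow> 'a \<Rightarrow> real \<Rightarrow> 'a set set" where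
  "comb_rhomboid A z \<rho> = {A_in A z \<rho> \<union> Q | Q. Q \<subseteq> A_on A z \<rho>}"

definition comb_rhomboids :: "'a::euclidean_space set \<Rightarrow> 'a set set set" where
  "comb_rhomboids A = {comb_rhomboid A z \<rho> | z \<rho>. 0 < \<rho>}"

definition vertex_emb :: "'a::euclidean_space set \<Rightarrow> 'a \<times> real" where
  "vertex_emb v = (\<Sum>a\<in>v. a, - real (card v))"

definition geom_rhomboid :: "'a::euclidean_space set set \<Rightarrow> ('a \<times> real) set" where
  "geom_rhomboid R = convex hull (vertex_emb ` R)"

definition r_rho :: "'a::euclidean_space set \<Rightarrow> 'a set set \<Rightarrow> real" where
  "r_rho A R = Inf {\<rho>. 0 < \<rho> \<and> (\<exists>z. comb_rhomboid A z \<rho> = R)}"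

definition k_rho :: "'a set set \<Rightarrow> nat" where
  "k_rho R = Min (card ` R)"

definition Rhomb :: "'a::euclidean_space set \<Rightarrow> real \<Rightarrow> nat \<Rightarrow> ('a \<times> real) set" where
  "Rhomb A r k = \<Union> {geom_rhomboid R | R. R \<in> comb_rhomboids A \<and> r_rho A R \<le> r \<and> k \<le> k_rho R}"

definition Rhomb_bif :: "'a::euclidean_space set \<Rightarrow> real \<Rightarrow> nat \<Rightarrow> ('a \<times> real) topology" where
  "Rhomb_bif A r k = subtopology euclidean (Rhomb A r k)"

end

theory Submission
  imports Defs
begin

text \<open>Spheres are points of a space cut by one hyperplane per site, and the rhomboids are dual to the
  cells of this arrangement. Let Z(r, k) be the set of pairs (p, y) where p is a sphere of radius at
  most r and y is a point of its rhomboid of depth at least k. Both projections of Z(r, k) have convex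
  fibres: the fibre over p is a truncated rhomboid, the fibre over y is a cell cut by a paraboloid.
  A projection with convex fibres between finite unions of compact convex sets is a homotopy
  equivalence, as an approximate section obtained from a partition of unity can be retracted into the
  total space. The image of Z(r, k) in the space of spheres projects to Cov(r, k), again with convex
  fibres (a sphere may shrink as long as it encloses k sites), and the other image is the part of the
  rhomboids of radius at most r at depth at least k. It contains Rhomb(r, k), which is recovered
  up to homotopy by scaling the coordinates in each rhomboid. All maps commute with the
  inclusions except the last retraction, which is only needed for fixed (r, k).\<close>

section \<open>Homotopy equivalences and coded spaces\<close>

text \<open>A centre does not single out a point of the tiling, nor a point a centre; this is why
  pairs are used. Depth is bounded in the middle by the total weight: having k coordinates equal to
  1, as in \<open>Rhomb\<close>, describes a union of faces of a cube, in general not convex, while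
  a bound on the sum is a half-space. Convexity of the fibre over a point is not evident either,
  since the point may lie in several rhomboids; a duality argument as in linear programming shows
  that all spheres whose rhomboids contain the point accept the same weights. General position
  enters through affine independence of the sites on one sphere. It makes the weights of a point
  unique, so that scaling them is well defined, and it lets a small perturbation realise any sign
  pattern of these sites, so that each closed cell of spheres is approached by genuine spheres of
  nearly the same radius.\<close>

lemma homotopy_equivalence_map_compose:
  assumes "homotopy_equivalence_map X Y f" "homotopy_equivalence_map Y Z g"
  shows "homotopy_equivalence_map X Z (g \<circ> f)"
proof -
  obtain f' where f: "continuous_map X Y f" "continuous_map Y X f'"
    "homotopic_with (\<lambda>h. True) X X (f' \<circ> f) id" "homotopic_with (\<lambda>h. True) Y Y (f \<circ> f') id"
    using assms(1) unfolding homotopy_equivalence_map_def by blast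
  obtain g' where g: "continuous_map Y Z g" "continuous_map Z Y g'"
    "homotopic_with (\<lambda>h. True) Y Y (g' \<circ> g) id" "homotopic_with (\<lambda>h. True) Z Z (g \<circ> g') id"
    using assms(2) unfolding homotopy_equivalence_map_def by blast
  have "homotopic_with (\<lambda>h. True) X Y ((g' \<circ> g) \<circ> f) (id \<circ> f)"
    by (rule homotopic_with_compose_continuous_map_right[OF g(3) f(1)]) simp
  then have "homotopic_with (\<lambda>h. True) X X (f' \<circ> ((g' \<circ> g) \<circ> f)) (f' \<circ> (id \<circ> f))"
    by (rule homotopic_with_compose_continuous_map_left[OF _ f(2)]) simp
  then have 1: "homotopic_with (\<lambda>h. True) X X ((f' \<circ> g') \<circ> (g \<circ> f)) id"
    using homotopic_with_trans[OF _ f(3)] by (simp add: comp_assoc)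
  have "homotopic_with (\<lambda>h. True) Z Y ((f \<circ> f') \<circ> g') (id \<circ> g')"
    by (rule homotopic_with_compose_continuous_map_right[OF f(4) g(2)]) simp
  then have "homotopic_with (\<lambda>h. True) Z Z (g \<circ> ((f \<circ> f') \<circ> g')) (g \<circ> (id \<circ> g'))"
    by (rule homotopic_with_compose_continuous_map_left[OF _ g(1)]) simp
  then have 2: "homotopic_with (\<lambda>h. True) Z Z ((g \<circ> f) \<circ> (f' \<circ> g')) id"
    using homotopic_with_trans[OF _ g(4)] by (simp add: comp_assoc)
  show ?thesis
    unfolding homotopy_equivalence_map_def
    using 1 2 continuous_map_compose[OF f(1) g(1)] continuous_map_compose[OF g(2) f(2)] by blast
qed

lemma homeomorphic_maps_imp_homotopy_equivalence_map:
  assumes "homeomorphic_maps X Y f g"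
  shows "homotopy_equivalence_map X Y f"
proof -
  have "homotopic_with (\<lambda>h. True) X X (g \<circ> f) id" "homotopic_with (\<lambda>h. True) Y Y (f \<circ> g) id"
    using assms unfolding homeomorphic_maps_def
    by (auto intro!: homotopic_with_equal continuous_map_compose)
  then show ?thesis
    using assms unfolding homotopy_equivalence_map_def homeomorphic_maps_def by blast
qed

text \<open>The intermediate bifiltrations of a zigzag live on the type \<open>real set\<close>, so subspaces of
  Euclidean spaces are transported there along an injection.\<close>

lemma ex_inj_real_set:
  "\<exists>e :: 'b::{second_countable_topology, t2_space} \<Rightarrow> real set. inj e"
proof -
  obtain B :: "'b set set" where B: "countable B" "topological_basis B"
    using ex_countable_basis by blast
  \<comment> \<open>A point of a Hausdorff space is determined by the basic open sets around it;
    numbering a countable basis turns this family into a set of naturals, then of reals.\<close>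
  define e :: "'b \<Rightarrow> real set" where "e x = of_nat ` to_nat_on B ` {U \<in> B. x \<in> U}" for x
  have "inj e"
  proof
    fix x y assume "e x = e y"
    then have eq: "to_nat_on B ` {U \<in> B. x \<in> U} = to_nat_on B ` {U \<in> B. y \<in> U}"
      unfolding e_def by (simp add: inj_image_eq_iff inj_of_nat)
    have "{U \<in> B. x \<in> U} = {U \<in> B. y \<in> U}"
      using inj_on_image_eq_iff[OF inj_on_to_nat_on[OF B(1)], of "{U \<in> B. x \<in> U}" "{U \<in> B. y \<in> U}"] eq
      by auto
    show "x = y"
    proof (rule ccontr)
      assume "x \<noteq> y"
      then obtain U where U: "open U" "x \<in> U" "y \<notin> U"
        using hausdorff[of x y] by blast
      then obtain V where "V \<in> B" "x \<in> V" "V \<subseteq> U"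
        using topological_basisE[OF B(2)] by blast
      then show False
        using U \<open>{U \<in> B. x \<in> U} = {U \<in> B. y \<in> U}\<close> by blast
    qed
  qed
  then show ?thesis by blast
qed

text \<open>One injection is fixed for the whole type, so nested sets get nested codes and
  inclusions remain identity maps.\<close>

definition real_set_code :: "'b::euclidean_space \<Rightarrow> real set" where
  "real_set_code = (SOME e. inj e)"

lemma inj_real_set_code: "inj (real_set_code :: 'b::euclidean_space \<Rightarrow> real set)"
  unfolding real_set_code_def using ex_inj_real_set by (rule someI_ex)

definition coded_space :: "'b::euclidean_space set \<Rightarrow> real set topology" where
  "coded_space S = pullback_topology (real_set_code ` S) (inv (real_set_code :: 'b \<Rightarrow> _)) euclidean"

lemma topspace_coded_space: "topspace (coded_space S) = real_set_code ` S"
  unfolding coded_space_def topspace_pullback_topology by auto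

lemma homeomorphic_maps_coded_space:
  "homeomorphic_maps (top_of_set S) (coded_space S) real_set_code (inv real_set_code)"
  unfolding homeomorphic_maps_def
proof (intro conjI ballI)
  have "(inv real_set_code \<circ> real_set_code) = (id :: 'a \<Rightarrow> 'a)"
    by (simp add: inj_real_set_code)
  then show "continuous_map (top_of_set S) (coded_space S) real_set_code"
    unfolding coded_space_def by (intro continuous_map_pullback') auto
  have "continuous_map (coded_space S) euclidean (id \<circ> inv (real_set_code :: 'a \<Rightarrow> _))"
    unfolding coded_space_def by (intro continuous_map_pullback) auto
  then show "continuous_map (coded_space S) (top_of_set S) (inv real_set_code)"
    by (auto simp: continuous_map_in_subtopology topspace_coded_space inj_real_set_code)
qed (auto simp: topspace_coded_space inj_real_set_code)

lemma is_bifiltration_top_of_set: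
  assumes "\<And>r k r' k'. 0 \<le> r \<Longrightarrow> r \<le> r' \<Longrightarrow> 1 \<le> k' \<Longrightarrow> k' \<le> k \<Longrightarrow> S r k \<subseteq> S r' k'"
  shows "is_bifiltration (\<lambda>r k. top_of_set (S r k))"
proof -
  have "continuous_map (top_of_set U) (top_of_set V) id" if "U \<subseteq> V" for U V :: "'a set"
    using that by auto
  then show ?thesis
    unfolding is_bifiltration_def using assms by simp
qed

lemma is_bifiltration_coded_space:
  assumes "\<And>r k r' k'. 0 \<le> r \<Longrightarrow> r \<le> r' \<Longrightarrow> 1 \<le> k' \<Longrightarrow> k' \<le> k \<Longrightarrow> S r k \<subseteq> S r' k'"
  shows "is_bifiltration (\<lambda>r k. coded_space (S r k))"
proof -
  have "continuous_map (coded_space S) (coded_space T) id" if "S \<subseteq> T" for S T :: "'a set"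
  proof -
    have "continuous_map (coded_space S) (coded_space T) (real_set_code \<circ> ((id :: 'a \<Rightarrow> 'a) \<circ> inv real_set_code))"
    proof (intro continuous_map_compose)
      show "continuous_map (coded_space S) (top_of_set S) (inv real_set_code)"
        using homeomorphic_maps_coded_space unfolding homeomorphic_maps_def by blast
      show "continuous_map (top_of_set S) (top_of_set T) id"
        using that by auto
      show "continuous_map (top_of_set T) (coded_space T) real_set_code"
        using homeomorphic_maps_coded_space unfolding homeomorphic_maps_def by blast
    qed
    then show ?thesis
      by (rule continuous_map_eq) (auto simp: topspace_coded_space inj_real_set_code)
  qed
  then show ?thesis
    unfolding is_bifiltration_def using assms by (simp add: topspace_coded_space image_mono)
qed

lemma he_linked_sym: "he_linked X Y \<Longrightarrow> he_linked Y X"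
  unfolding he_linked_def by blast

lemma objectwise_he_morphism_coded_space_dom:
  assumes "objectwise_he_morphism (\<lambda>r k. top_of_set (S r k)) X f"
  shows "objectwise_he_morphism (\<lambda>r k. coded_space (S r k)) X (\<lambda>r k. f r k \<circ> inv real_set_code)"
proof -
  have "homotopy_equivalence_map (coded_space (S r k)) (X r k) (f r k \<circ> inv real_set_code)"
    if "0 \<le> r" "1 \<le> k" for r k
  proof (rule homotopy_equivalence_map_compose)
    show "homotopy_equivalence_map (coded_space (S r k)) (top_of_set (S r k)) (inv real_set_code)"
      using homeomorphic_maps_coded_space homeomorphic_maps_sym
        homeomorphic_maps_imp_homotopy_equivalence_map by blast
    show "homotopy_equivalence_map (top_of_set (S r k)) (X r k) (f r k)"
      using assms that unfolding objectwise_he_morphism_def by blast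
  qed
  then show ?thesis
    using assms unfolding objectwise_he_morphism_def
    by (simp add: topspace_coded_space inj_real_set_code)
qed

lemma objectwise_he_morphism_coded_space_cod:
  assumes "objectwise_he_morphism X (\<lambda>r k. top_of_set (S r k)) f"
  shows "objectwise_he_morphism X (\<lambda>r k. coded_space (S r k)) (\<lambda>r k. real_set_code \<circ> f r k)"
proof -
  have "homotopy_equivalence_map (X r k) (coded_space (S r k)) (real_set_code \<circ> f r k)"
    if "0 \<le> r" "1 \<le> k" for r k
  proof (rule homotopy_equivalence_map_compose)
    show "homotopy_equivalence_map (top_of_set (S r k)) (coded_space (S r k)) real_set_code"
      using homeomorphic_maps_coded_space homeomorphic_maps_imp_homotopy_equivalence_map by blast
    show "homotopy_equivalence_map (X r k) (top_of_set (S r k)) (f r k)"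
      using assms that unfolding objectwise_he_morphism_def by blast
  qed
  then show ?thesis
    using assms unfolding objectwise_he_morphism_def by fastforce
qed

lemma he_linked_coded_space:
  assumes "he_linked (\<lambda>r k. top_of_set (S r k)) X"
  shows "he_linked (\<lambda>r k. coded_space (S r k)) X"
  using assms objectwise_he_morphism_coded_space_dom objectwise_he_morphism_coded_space_cod
  unfolding he_linked_def by blast

section \<open>Maps with convex fibres\<close>

text \<open>The fibres of a map out of a compact set vary upper semicontinuously; averaging points of
  nearby convex fibres with a partition of unity gives an approximate section.\<close>

lemma approximate_section:
  fixes Z :: "'b::euclidean_space set" and q :: "'b \<Rightarrow> 'c::euclidean_space"
  assumes Z: "compact Z" and q: "continuous_on Z q"
    and conv: "\<And>x. convex {z \<in> Z. q z = x}" and e: "0 < e"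
  obtains f where "continuous_on (q ` Z) f"
    and "\<And>z. z \<in> Z \<Longrightarrow> \<exists>c \<in> q ` Z. dist (q z) c < e \<and>
           (\<forall>u \<in> closed_segment z (f (q z)). \<exists>z' \<in> Z. q z' = c \<and> dist u z' < e)"
proof -
  define X where "X = q ` Z"
  define F where "F x = {z \<in> Z. q z = x}" for x
  \<comment> \<open>The open \<open>e\<close>-neighbourhood of the fibre, written as a Minkowski
    sum: it is convex because both summands are, and open because the ball is.\<close>
  define N where "N x = (\<Union>a\<in>F x. \<Union>b\<in>ball 0 e. {a + b})" for x
  have "compact X"
    unfolding X_def using Z q by (rule compact_continuous_image[rotated])
  have N_iff: "u \<in> N x \<longleftrightarrow> (\<exists>z\<in>F x. dist u z < e)" for u x
  proof
    assume "u \<in> N x"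
    then show "\<exists>z\<in>F x. dist u z < e"
      unfolding N_def by (force simp: dist_norm)
  next
    assume "\<exists>z\<in>F x. dist u z < e"
    then obtain z where z: "z \<in> F x" "dist u z < e" by blast
    then have "u - z \<in> ball 0 e" "u = z + (u - z)"
      by (auto simp: dist_norm norm_minus_commute)
    then show "u \<in> N x" unfolding N_def using z by blast
  qed
  have convN: "convex (N x)" for x
    unfolding N_def using conv by (intro convex_sums) (auto simp: F_def)
  have openN: "open (N x)" for x
    unfolding N_def by (intro open_sums) auto
  \<comment> \<open>Upper semicontinuity: the part of \<open>Z\<close> outside \<open>N x\<close> is
    compact, so its image is closed, and it misses \<open>x\<close>.\<close>
  have usc: "\<exists>d. 0 < d \<and> d \<le> e \<and> (\<forall>z\<in>Z. dist (q z) x < d \<longrightarrow> z \<in> N x)" if "x \<in> X" for x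
  proof -
    define K where "K = q ` (Z - N x)"
    have "compact (Z - N x)"
      using Z openN by (simp add: compact_diff)
    then have "closed K"
      unfolding K_def using q
      by (intro compact_imp_closed compact_continuous_image continuous_on_subset[OF q]) auto
    moreover have "z \<in> N (q z)" if "z \<in> Z" for z
      using e that by (auto simp: N_iff F_def intro!: exI[of _ z])
    then have "x \<notin> K"
      unfolding K_def by blast
    ultimately obtain d where d: "0 < d" "\<And>y. dist y x < d \<Longrightarrow> y \<notin> K"
      by (metis ComplD ComplI closed_def open_dist)
    then show ?thesis
      using e by (intro exI[of _ "min d e"]) (auto simp: K_def)
  qed
  then obtain D where D: "\<And>x. x \<in> X \<Longrightarrow> 0 < D x \<and> D x \<le> e \<and> (\<forall>z\<in>Z. dist (q z) x < D x \<longrightarrow> z \<in> N x)"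
    by metis
  have cover: "X \<subseteq> (\<Union>x\<in>X. ball x (D x / 2))"
    using D by force
  obtain C where C: "C \<subseteq> X" "finite C" "X \<subseteq> (\<Union>x\<in>C. ball x (D x / 2))"
    using compactE_image[OF \<open>compact X\<close> _ cover] by auto
  \<comment> \<open>A Lebesgue number in disguise. If \<open>x\<close> is within
    \<open>D c / 2\<close> of \<open>c\<close>, every centre within \<open>d\<close> of
    \<open>x\<close> is within \<open>D c\<close> of \<open>c\<close>, so all points averaged at
    \<open>x\<close> lie in one convex set \<open>N c\<close>. The entry 1 guards against an empty
    \<open>C\<close>.\<close>
  define d where "d = Min (insert 1 ((\<lambda>x. D x / 2) ` C))"
  have "0 < d"
    unfolding d_def using C D by (auto simp: subset_iff)
  moreover have "d \<le> D c / 2" if "c \<in> C" for c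
    unfolding d_def using C that by (intro Min_le) auto
  ultimately have d: "0 < d" "\<And>c. c \<in> C \<Longrightarrow> d \<le> D c / 2"
    by blast+
  have cover': "X \<subseteq> (\<Union>x\<in>X. ball x d)"
    using d by force
  obtain C' where C': "C' \<subseteq> X" "finite C'" "X \<subseteq> (\<Union>x\<in>C'. ball x d)"
    using compactE_image[OF \<open>compact X\<close> _ cover'] by auto
  have "\<forall>x\<in>X. \<exists>z\<in>Z. q z = x"
    unfolding X_def by auto
  then obtain v where v: "\<And>x. x \<in> X \<Longrightarrow> v x \<in> Z \<and> q (v x) = x"
    by metis
  \<comment> \<open>Hat functions of the balls of radius \<open>d\<close>; normalised by
    \<open>W\<close> they form the partition of unity that averages arbitrary points
    \<open>v i\<close> of the fibres.\<close>
  define w where "w i x = max 0 (d - dist x i)" for i x :: 'c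
  define W where "W x = (\<Sum>i\<in>C'. w i x)" for x
  define f where "f x = (\<Sum>i\<in>C'. (w i x / W x) *\<^sub>R v i)" for x
  have w0: "0 \<le> w i x" for i x
    unfolding w_def by simp
  have Wpos: "0 < W x" if "x \<in> X" for x
  proof -
    obtain i where "i \<in> C'" "dist x i < d"
      using C' \<open>x \<in> X\<close> by (auto simp: dist_commute)
    then show ?thesis
      unfolding W_def using C' w0 by (intro sum_pos2[of _ i]) (auto simp: w_def)
  qed
  have "continuous_on X f"
    unfolding f_def W_def w_def
    using Wpos unfolding W_def w_def by (intro continuous_intros) force+
  moreover have "\<exists>c \<in> X. dist (q z) c < e \<and>
      (\<forall>u \<in> closed_segment z (f (q z)). \<exists>z' \<in> Z. q z' = c \<and> dist u z' < e)" if "z \<in> Z" for z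
  proof -
    define x where "x = q z"
    have x: "x \<in> X"
      using that unfolding X_def x_def by auto
    obtain c where c: "c \<in> C" "dist x c < D c / 2"
      using C x by (auto simp: dist_commute)
    have "c \<in> X" using C c by auto
    note Dc = D[OF \<open>c \<in> X\<close>]
    have dxc: "dist x c < D c"
      using c(2) dist_not_less_zero[of x c] by linarith
    then have zN: "z \<in> N c"
      using Dc that unfolding x_def by auto
    have "(\<Sum>i\<in>{i\<in>C'. w i x \<noteq> 0}. (w i x / W x) *\<^sub>R v i) \<in> N c"
    proof (intro convex_sum convN)
      show "finite {i \<in> C'. w i x \<noteq> 0}" using C' by simp
      have "(\<Sum>i\<in>{i\<in>C'. w i x \<noteq> 0}. w i x) = W x"
        unfolding W_def using C' by (intro sum.mono_neutral_left) auto
      then show "(\<Sum>i\<in>{i\<in>C'. w i x \<noteq> 0}. w i x / W x) = 1"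
        using Wpos[OF x] by (simp flip: sum_divide_distrib)
      fix i assume "i \<in> {i\<in>C'. w i x \<noteq> 0}"
      then have i: "i \<in> C'" "dist x i < d" by (auto simp: w_def max_def split: if_splits)
      show "0 \<le> w i x / W x" using w0 Wpos[OF x] by (simp add: less_imp_le)
      have "dist i c \<le> dist x i + dist x c"
        by (metis add.commute dist_commute dist_triangle)
      then have "dist i c < D c"
        using i(2) c d(2)[OF c(1)] by linarith
      then show "v i \<in> N c"
        using Dc v[of i] i C' by auto
    qed
    moreover have "f x = (\<Sum>i\<in>{i\<in>C'. w i x \<noteq> 0}. (w i x / W x) *\<^sub>R v i)"
      unfolding f_def using C' by (intro sum.mono_neutral_right) auto
    ultimately have "f x \<in> N c" by simp
    then have "closed_segment z (f x) \<subseteq> N c"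
      using zN convN by (simp add: closed_segment_subset)
    then have "\<forall>u\<in>closed_segment z (f (q z)). \<exists>z'\<in>Z. q z' = c \<and> dist u z' < e"
      unfolding x_def by (auto simp: N_iff F_def subset_iff)
    moreover have "dist (q z) c < e"
      using dxc Dc unfolding x_def by linarith
    ultimately show ?thesis
      using \<open>c \<in> X\<close> by blast
  qed
  ultimately show ?thesis
    using that unfolding X_def by blast
qed

text \<open>The approximate section lands near \<open>Z\<close>, where the neighbourhood retraction
  \<open>r\<close> pushes it into \<open>Z\<close>. Segments from \<open>z\<close> to
  \<open>f (q z)\<close> stay near \<open>Z\<close>, so \<open>r\<close> turns them into a homotopy
  in \<open>Z\<close>; on the image, \<open>q \<circ> g\<close> is close to the identity and a
  retraction \<open>s\<close> repairs the straight homotopy. The Lipschitz bound makes sense of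
  \<open>q\<close> off \<open>Z\<close> and transfers estimates to the image; coordinate projections
  satisfy it.\<close>

lemma homotopy_equivalence_map_convex_fibres:
  fixes Z :: "'b::euclidean_space set" and q :: "'b \<Rightarrow> 'c::euclidean_space"
  assumes Z: "compact Z" "ENR Z" and X: "ENR (q ` Z)"
    and conv: "\<And>x. convex {z \<in> Z. q z = x}"
    and lip: "\<And>z z'. dist (q z) (q z') \<le> dist z z'"
  shows "homotopy_equivalence_map (top_of_set Z) (top_of_set (q ` Z)) q"
proof -
  define X where "X = q ` Z"
  have q: "continuous_on S q" for S
    unfolding continuous_on_iff using lip by (meson le_less_trans)
  have "compact X"
    unfolding X_def using Z q by (simp add: compact_continuous_image)
  obtain V s where V: "open V" "retraction V X s"
    using assms(3) unfolding ENR_def retract_of_def X_def by blast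
  then obtain \<eta> where \<eta>: "0 < \<eta>" "(\<Union>x\<in>X. ball x \<eta>) \<subseteq> V"
    using compact_subset_open_imp_ball_epsilon_subset[OF \<open>compact X\<close> V(1)]
    unfolding retraction_def by blast
  obtain U r where U: "open U" "retraction U Z r"
    using assms(2) unfolding ENR_def retract_of_def by blast
  have r: "Z \<subseteq> U" "continuous_on U r" "r ` U \<subseteq> Z" "\<And>z. z \<in> Z \<Longrightarrow> r z = z"
    using U(2) unfolding retraction_def by auto
  have s: "X \<subseteq> V" "continuous_on V s" "s ` V \<subseteq> X" "\<And>x. x \<in> X \<Longrightarrow> s x = x"
    using V(2) unfolding retraction_def by auto
  \<comment> \<open>Near \<open>Z\<close> the retraction moves points little as seen through
    \<open>q\<close>, so retracting \<open>f\<close> does not spoil the approximate section.\<close>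
  define U' where "U' = {u \<in> U. dist (q (r u)) (q u) < \<eta> / 2}"
  have "open U'"
  proof -
    have "continuous_on U (\<lambda>u. dist (q (r u)) (q u))"
      by (intro continuous_intros continuous_on_compose2[OF q r(2)] q) auto
    then have "open (U \<inter> (\<lambda>u. dist (q (r u)) (q u)) -` {..<\<eta>/2})"
      by (rule continuous_open_preimage[OF _ U(1)]) auto
    moreover have "U' = U \<inter> (\<lambda>u. dist (q (r u)) (q u)) -` {..<\<eta>/2}"
      unfolding U'_def by auto
    ultimately show ?thesis by simp
  qed
  moreover have "Z \<subseteq> U'"
    unfolding U'_def using r \<eta> by auto
  ultimately obtain e0 where e0: "0 < e0" "(\<Union>z\<in>Z. ball z e0) \<subseteq> U'"
    using compact_subset_open_imp_ball_epsilon_subset[OF Z(1)] by blast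
  \<comment> \<open>\<open>e0\<close> keeps the segments inside \<open>U'\<close>; with \<eta>/4,
    two errors below \<open>e\<close> and one below \<eta>/2 add up to less than \<eta>.\<close>
  define e where "e = min e0 (\<eta> / 4)"
  have e: "0 < e" "e \<le> e0" "e \<le> \<eta> / 4"
    unfolding e_def using e0 \<eta> by auto
  obtain f where f: "continuous_on X f"
    and near: "\<And>z. z \<in> Z \<Longrightarrow> \<exists>c \<in> X. dist (q z) c < e \<and>
           (\<forall>u \<in> closed_segment z (f (q z)). \<exists>z' \<in> Z. q z' = c \<and> dist u z' < e)"
    using approximate_section[OF Z(1) q conv e(1)] unfolding X_def by metis
  have seg: "closed_segment z (f (q z)) \<subseteq> U'" if z: "z \<in> Z" for z
  proof
    fix u assume "u \<in> closed_segment z (f (q z))"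
    then obtain z' where "z' \<in> Z" "dist u z' < e"
      using near[OF z] by blast
    then have "u \<in> ball z' e0" using e by (simp add: dist_commute)
    then show "u \<in> U'" using e0 \<open>z' \<in> Z\<close> by blast
  qed
  have fU: "f x \<in> U'" if "x \<in> X" for x
    using that seg unfolding X_def by auto
  define g where "g = r \<circ> f"
  have cont_g: "continuous_on X g"
    unfolding g_def using f fU by (intro continuous_on_compose continuous_on_subset[OF r(2)]) (auto simp: U'_def)
  then have cont_qg: "continuous_on X (q \<circ> g)"
    using q by (rule continuous_on_compose)
  have gZ: "g x \<in> Z" if "x \<in> X" for x
    unfolding g_def using fU[OF that] r(3) by (auto simp: U'_def)
  have "homotopic_with_canon (\<lambda>h. True) Z U' id (f \<circ> q)"
    using seg f q by (intro homotopic_with_linear continuous_on_compose) (auto simp: X_def id_def)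
  then have "homotopic_with_canon (\<lambda>h. True) Z Z (r \<circ> id) (r \<circ> (f \<circ> q))"
    by (rule homotopic_with_compose_continuous_left[OF _ continuous_on_subset[OF r(2)]])
      (use r(3) in \<open>auto simp: U'_def\<close>)
  moreover have "homotopic_with_canon (\<lambda>h. True) Z Z id (r \<circ> id)"
    by (rule homotopic_with_equal) (use r in auto)
  ultimately have 1: "homotopic_with_canon (\<lambda>h. True) Z Z (g \<circ> q) id"
    unfolding g_def using homotopic_with_trans homotopic_with_symD by (metis comp_assoc)
  have close: "dist x (q (g x)) < \<eta>" if "x \<in> X" for x
  proof -
    obtain z where z: "z \<in> Z" "x = q z" using \<open>x \<in> X\<close> unfolding X_def by auto
    obtain c where c: "dist x c < e"
        "\<forall>u \<in> closed_segment z (f (q z)). \<exists>z' \<in> Z. q z' = c \<and> dist u z' < e"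
      using near[OF z(1)] z by blast
    then obtain z' where "q z' = c" "dist (f x) z' < e"
      using z by auto
    then have "dist (q (f x)) c < e"
      using lip le_less_trans by blast
    moreover have "dist (q (g x)) (q (f x)) < \<eta> / 2"
      using fU[OF that] unfolding U'_def g_def by auto
    moreover have "dist x (q (g x)) \<le> dist x c + dist (q (f x)) c + dist (q (g x)) (q (f x))"
      by (smt (verit) dist_commute dist_triangle)
    ultimately show ?thesis
      using c(1) e by linarith
  qed
  have "homotopic_with_canon (\<lambda>h. True) X V id (q \<circ> g)"
  proof (rule homotopic_with_linear)
    fix x assume x: "x \<in> X"
    have "closed_segment x (q (g x)) \<subseteq> ball x \<eta>"
      using close[OF x] \<eta> by (intro closed_segment_subset) auto
    then show "closed_segment (id x) ((q \<circ> g) x) \<subseteq> V"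
      using \<eta>(2) x by auto
  qed (use cont_qg in \<open>auto simp: id_def\<close>)
  then have "homotopic_with_canon (\<lambda>h. True) X X (s \<circ> id) (s \<circ> (q \<circ> g))"
    by (rule homotopic_with_compose_continuous_left[OF _ s(2)]) (use s(3) in auto)
  moreover have "homotopic_with_canon (\<lambda>h. True) X X id (s \<circ> id)"
    by (rule homotopic_with_equal) (use s in auto)
  moreover have "homotopic_with_canon (\<lambda>h. True) X X (s \<circ> (q \<circ> g)) (q \<circ> g)"
    by (rule homotopic_with_symD, rule homotopic_with_equal)
      (use s gZ cont_qg in \<open>auto simp: X_def\<close>)
  ultimately have 2: "homotopic_with_canon (\<lambda>h. True) X X (q \<circ> g) id"
    using homotopic_with_trans homotopic_with_symD by metis
  have "continuous_map (top_of_set Z) (top_of_set X) q"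
    using q by (auto simp: X_def)
  moreover have "continuous_map (top_of_set X) (top_of_set Z) g"
    using cont_g gZ by auto
  ultimately show ?thesis
    unfolding homotopy_equivalence_map_def X_def[symmetric] using 1 2 by blast
qed

section \<open>Spheres and faces\<close>

text \<open>The sphere with centre z and radius \<rho> is encoded as the point \<open>(z, \<rho>\<^sup>2 - z \<bullet> z)\<close>. In these
  coordinates \<open>\<rho>\<^sup>2 - (dist z a)\<^sup>2\<close> is affine, so a site cuts the space of spheres along a hyperplane.\<close>

definition site_height :: "'a::euclidean_space \<Rightarrow> 'a \<times> real \<Rightarrow> real" where
  "site_height a p = snd p + 2 * (a \<bullet> fst p) - a \<bullet> a"

text \<open>Convex rather than affine: bounding it leaves the region on or below a paraboloid.
  Points with a negative value carry no sphere; a site of nonnegative height excludes them.\<close>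

definition sq_radius :: "'a::euclidean_space \<times> real \<Rightarrow> real" where
  "sq_radius p = snd p + fst p \<bullet> fst p"

lemma site_height_eq: "site_height a p = sq_radius p - (dist (fst p) a)\<^sup>2"
  unfolding site_height_def sq_radius_def dist_norm power2_norm_eq_inner
  by (simp add: inner_diff inner_commute)

lemma site_height_add_scale:
  "site_height a (p + t *\<^sub>R q) = site_height a p + t * (snd q + 2 * (a \<bullet> fst q))"
  unfolding site_height_def by (simp add: algebra_simps)

lemma continuous_on_site_height [continuous_intros]: "continuous_on S (site_height a)"
  unfolding site_height_def by (intro continuous_intros)

lemma continuous_on_sq_radius [continuous_intros]: "continuous_on S sq_radius"
  unfolding sq_radius_def by (intro continuous_intros)

lemma site_height_convex_comb:
  assumes "u + v = 1"
  shows "site_height a (u *\<^sub>R p + v *\<^sub>R q) = u * site_height a p + v * site_height a q"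
proof -
  have v: "v = 1 - u" using assms by simp
  show ?thesis unfolding site_height_def v by (simp add: algebra_simps)
qed

text \<open>The gap is \<open>u * v\<close> times the squared distance of the two centres.\<close>

lemma sq_radius_convex_comb:
  assumes "0 \<le> u" "0 \<le> v" "u + v = 1"
  shows "sq_radius (u *\<^sub>R p + v *\<^sub>R q) \<le> u * sq_radius p + v * sq_radius q"
proof -
  have v: "v = 1 - u" using assms by simp
  have "u * sq_radius p + v * sq_radius q - sq_radius (u *\<^sub>R p + v *\<^sub>R q)
      = u * v * ((fst p - fst q) \<bullet> (fst p - fst q))"
    unfolding sq_radius_def v by (simp add: inner_add inner_diff inner_commute algebra_simps)
  also have "\<dots> \<ge> 0" using assms by simp
  finally show ?thesis by simp
qed

lemma convex_sq_radius_le: "convex {p. sq_radius p \<le> c}"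
proof (rule convexI)
  fix p q :: "'a \<times> real" and u v :: real
  assume *: "p \<in> {p. sq_radius p \<le> c}" "q \<in> {p. sq_radius p \<le> c}" "0 \<le> u" "0 \<le> v" "u + v = 1"
  then have "u * sq_radius p + v * sq_radius q \<le> c"
    using convex_bound_le by blast
  then show "u *\<^sub>R p + v *\<^sub>R q \<in> {p. sq_radius p \<le> c}"
    using sq_radius_convex_comb[OF *(3-5), of p q] by simp
qed

lemma convex_site_height: "convex {p. 0 \<le> site_height a p}" "convex {p. site_height a p \<le> 0}"
  by (auto simp: convex_def site_height_convex_comb intro!: add_nonneg_nonneg add_nonpos_nonpos mult_nonneg_nonpos)

text \<open>An enclosed site keeps the centre within \<open>r\<close> of it and the squared radius
  nonnegative, so centre and squared radius range over a compact product, which is mapped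
  continuously to the encoding.\<close>

lemma compact_spheres_enclosing:
  assumes "0 \<le> r"
  shows "compact {p. sq_radius p \<le> r\<^sup>2 \<and> 0 \<le> site_height a p}"
proof (rule compact_eq_bounded_closed[THEN iffD2], rule conjI)
  have "{p. sq_radius p \<le> r\<^sup>2 \<and> 0 \<le> site_height a p}
      \<subseteq> (\<lambda>(z, t). (z, t - z \<bullet> z)) ` (cball a r \<times> {0..r\<^sup>2})"
  proof
    fix p assume p: "p \<in> {p. sq_radius p \<le> r\<^sup>2 \<and> 0 \<le> site_height a p}"
    then have d: "(dist (fst p) a)\<^sup>2 \<le> sq_radius p"
      by (simp add: site_height_eq)
    then have "(dist (fst p) a)\<^sup>2 \<le> r\<^sup>2" "0 \<le> sq_radius p"
      using p by (auto intro: order_trans[OF zero_le_power2])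
    then have "fst p \<in> cball a r" "sq_radius p \<in> {0..r\<^sup>2}"
      using assms p by (auto simp: dist_commute power2_le_iff_abs_le)
    moreover have "p = (\<lambda>(z, t). (z, t - z \<bullet> z)) (fst p, sq_radius p)"
      by (simp add: sq_radius_def)
    ultimately show "p \<in> (\<lambda>(z, t). (z, t - z \<bullet> z)) ` (cball a r \<times> {0..r\<^sup>2})"
      by blast
  qed
  moreover have "compact ((\<lambda>(z, t). (z, t - z \<bullet> z)) ` (cball a r \<times> {0..r\<^sup>2}))"
    by (intro compact_continuous_image compact_Times) (auto simp: case_prod_beta intro!: continuous_intros)
  ultimately show "bounded {p. sq_radius p \<le> r\<^sup>2 \<and> 0 \<le> site_height a p}"
    using bounded_subset compact_imp_bounded by blast
  show "closed {p. sq_radius p \<le> r\<^sup>2 \<and> 0 \<le> site_height a p}"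
    by (intro closed_Collect_conj closed_Collect_le continuous_intros)
qed

text \<open>A weight \<open>l\<close> encodes the point of \<open>\<rho>\<^sub>S\<close> with coordinates \<open>l a\<close> along the sites on S.\<close>

definition compatible :: "'a::euclidean_space set \<Rightarrow> 'a \<times> real \<Rightarrow> ('a \<Rightarrow> real) \<Rightarrow> bool" where
  "compatible A p l \<longleftrightarrow> (\<forall>a\<in>A. 0 \<le> l a \<and> l a \<le> 1 \<and>
     (0 < site_height a p \<longrightarrow> l a = 1) \<and> (site_height a p < 0 \<longrightarrow> l a = 0))"

text \<open>The vectors \<open>c\<close> remain a parameter: besides the embedding, variants with
  one more coordinate are used that record the total weight or a single weight.\<close>

definition weighted_sum :: "'a set \<Rightarrow> ('a \<Rightarrow> 'v::real_vector) \<Rightarrow> ('a \<Rightarrow> real) \<Rightarrow> 'v" where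
  "weighted_sum A c l = (\<Sum>a\<in>A. l a *\<^sub>R c a)"

definition weight_emb :: "'a::euclidean_space set \<Rightarrow> ('a \<Rightarrow> real) \<Rightarrow> 'a \<times> real" where
  "weight_emb A = weighted_sum A (\<lambda>a. (a, -1))"

definition face_weights :: "'a set \<Rightarrow> 'a set \<Rightarrow> 'a set \<Rightarrow> ('a \<Rightarrow> real) set" where
  "face_weights A I J = {l. (\<forall>a\<in>A. 0 \<le> l a \<and> l a \<le> 1) \<and> (\<forall>a\<in>I. l a = 1) \<and> (\<forall>a\<in>J. l a = 0)}"

text \<open>The closed cell dual to a rhomboid, for disjoint \<open>I\<close> and \<open>J\<close>:
  sites of \<open>I\<close> inside or on the sphere, sites of \<open>J\<close> outside or on it, all
  others on it. Relaxing the strict signs is what makes the cell closed.\<close>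

definition face_spheres :: "'a::euclidean_space set \<Rightarrow> 'a set \<Rightarrow> 'a set \<Rightarrow> real \<Rightarrow> ('a \<times> real) set" where
  "face_spheres A I J r = {p. sq_radius p \<le> r\<^sup>2 \<and>
     (\<forall>a\<in>A - J. 0 \<le> site_height a p) \<and> (\<forall>a\<in>A - I. site_height a p \<le> 0)}"

text \<open>\<open>J\<close> is a proper subset because spheres that enclose no site can escape to
  infinity, so the cell for \<open>J = A\<close> is not compact.\<close>

definition faces :: "'a set \<Rightarrow> ('a set \<times> 'a set) set" where
  "faces A = {(I, J). I \<subseteq> A \<and> J \<subset> A \<and> I \<inter> J = {}}"

lemma finite_faces: "finite A \<Longrightarrow> finite (faces A)"
  by (rule finite_subset[of _ "Pow A \<times> Pow A"]) (auto simp: faces_def)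

lemma compatible_face:
  assumes "p \<in> face_spheres A I J r" "l \<in> face_weights A I J"
  shows "compatible A p l"
  unfolding compatible_def
proof (intro ballI conjI impI)
  fix a assume "a \<in> A"
  then show "0 \<le> l a" "l a \<le> 1" using assms by (auto simp: face_weights_def)
  show "l a = 1" if "0 < site_height a p"
    using assms that \<open>a \<in> A\<close> unfolding face_spheres_def face_weights_def by force
  show "l a = 0" if "site_height a p < 0"
    using assms that \<open>a \<in> A\<close> unfolding face_spheres_def face_weights_def by force
qed

lemma compatible_imp_face:
  assumes "compatible A p l" "sq_radius p \<le> r\<^sup>2"
  shows "p \<in> face_spheres A {a \<in> A. l a = 1} {a \<in> A. l a = 0} r"
    and "l \<in> face_weights A {a \<in> A. l a = 1} {a \<in> A. l a = 0}"
proof -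
  have "site_height a p \<ge> 0" if "a \<in> A" "l a \<noteq> 0" for a
    using assms(1) that unfolding compatible_def by (meson not_less)
  moreover have "site_height a p \<le> 0" if "a \<in> A" "l a \<noteq> 1" for a
    using assms(1) that unfolding compatible_def by (meson not_less)
  ultimately show "p \<in> face_spheres A {a \<in> A. l a = 1} {a \<in> A. l a = 0} r"
    using assms(2) unfolding face_spheres_def by auto
  show "l \<in> face_weights A {a \<in> A. l a = 1} {a \<in> A. l a = 0}"
    using assms(1) unfolding compatible_def face_weights_def by auto
qed

text \<open>Splits a relation between spheres and weights into finitely many products of a cell and
  a face. The face is read off from the weights equal to 1 and to 0; a total of at least 1 prevents
  all of them from vanishing.\<close>

lemma compatible_iff_face:
  assumes "finite A" "1 \<le> k" "real k \<le> sum l A"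
  shows "compatible A p l \<and> sq_radius p \<le> r\<^sup>2 \<longleftrightarrow>
    (\<exists>(I, J) \<in> faces A. p \<in> face_spheres A I J r \<and> l \<in> face_weights A I J)"
proof
  assume *: "compatible A p l \<and> sq_radius p \<le> r\<^sup>2"
  have "{a \<in> A. l a = 0} \<noteq> A"
  proof
    assume "{a \<in> A. l a = 0} = A"
    then have "sum l A = 0" by (intro sum.neutral) blast
    then show False using assms by simp
  qed
  then have "({a \<in> A. l a = 1}, {a \<in> A. l a = 0}) \<in> faces A"
    unfolding faces_def by auto
  then show "\<exists>(I, J) \<in> faces A. p \<in> face_spheres A I J r \<and> l \<in> face_weights A I J"
    using compatible_imp_face * by blast
next
  assume "\<exists>(I, J) \<in> faces A. p \<in> face_spheres A I J r \<and> l \<in> face_weights A I J"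
  then show "compatible A p l \<and> sq_radius p \<le> r\<^sup>2"
    using compatible_face unfolding face_spheres_def by blast
qed

lemma face_spheres_eq:
  "face_spheres A I J r = {p. sq_radius p \<le> r\<^sup>2} \<inter> (\<Inter>a\<in>A-J. {p. 0 \<le> site_height a p})
      \<inter> (\<Inter>a\<in>A-I. {p. site_height a p \<le> 0})"
  unfolding face_spheres_def by auto

lemma compact_face_spheres:
  assumes "0 \<le> r" "J \<subset> A"
  shows "compact (face_spheres A I J r)"
proof -
  obtain b where b: "b \<in> A - J" using assms by blast
  have "closed {p. 0 \<le> site_height a p}" "closed {p. site_height a p \<le> 0}" "closed {p :: 'a \<times> real. sq_radius p \<le> r\<^sup>2}" for a :: 'a
    by (intro closed_Collect_le continuous_intros)+
  then have "closed (face_spheres A I J r)"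
    unfolding face_spheres_eq by (intro closed_Int closed_INT) auto
  moreover have "face_spheres A I J r = {p. sq_radius p \<le> r\<^sup>2 \<and> 0 \<le> site_height b p} \<inter> face_spheres A I J r"
    using b unfolding face_spheres_def by auto
  ultimately show ?thesis
    using compact_spheres_enclosing[OF assms(1), of b] compact_Int_closed by metis
qed

lemma convex_face_spheres: "convex (face_spheres A I J r)"
  unfolding face_spheres_eq
  by (simp add: convex_Int convex_INT convex_sq_radius_le convex_site_height)

text \<open>Both sides are the zonotope spanned by the \<open>c a\<close>, translated by
  \<open>x\<close>. In the induction the weight of the new site \<open>b\<close> interpolates
  between the zonotope at \<open>x\<close> and its translate at \<open>x + c b\<close>, hence the
  arbitrary base point.\<close>

lemma convex_hull_subset_sums:
  fixes c :: "'b \<Rightarrow> 'v::real_vector"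
  assumes "finite S"
  shows "convex hull ((\<lambda>Q. x + sum c Q) ` Pow S) = {x + weighted_sum S c l | l. \<forall>a\<in>S. 0 \<le> l a \<and> l a \<le> 1}"
    (is "?L = ?R")
proof
  have "convex ?R"
  proof (rule convexI, clarify)
    fix l l' :: "'b \<Rightarrow> real" and u v :: real
    assume l: "\<forall>a\<in>S. 0 \<le> l a \<and> l a \<le> 1" "\<forall>a\<in>S. 0 \<le> l' a \<and> l' a \<le> 1"
      and uv: "0 \<le> u" "0 \<le> v" "u + v = 1"
    define m where "m a = u * l a + v * l' a" for a
    have "u *\<^sub>R x + v *\<^sub>R x = x"
      using uv by (simp flip: scaleR_left_distrib)
    then have "u *\<^sub>R (x + weighted_sum S c l) + v *\<^sub>R (x + weighted_sum S c l') = x + weighted_sum S c m"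
      unfolding weighted_sum_def m_def
      by (simp add: algebra_simps scaleR_sum_right sum.distrib)
    moreover have "\<forall>a\<in>S. 0 \<le> m a \<and> m a \<le> 1"
      unfolding m_def using l uv by (simp add: convex_bound_le)
    ultimately show "\<exists>m. u *\<^sub>R (x + weighted_sum S c l) + v *\<^sub>R (x + weighted_sum S c l') = x + weighted_sum S c m
        \<and> (\<forall>a\<in>S. 0 \<le> m a \<and> m a \<le> 1)"
      by blast
  qed
  moreover have "x + sum c Q \<in> ?R" if "Q \<subseteq> S" for Q
  proof -
    have "sum c Q = weighted_sum S c (\<lambda>a. if a \<in> Q then 1 else 0)"
      unfolding weighted_sum_def using assms that
      by (simp add: if_distrib[of "\<lambda>t. t *\<^sub>R _"] sum.inter_restrict[symmetric] Int_absorb1 cong: if_cong)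
    then show ?thesis by (auto intro!: exI[of _ "\<lambda>a. if a \<in> Q then 1 else 0"])
  qed
  ultimately show "?L \<subseteq> ?R"
    by (intro hull_minimal) auto
  have "x + weighted_sum S c l \<in> convex hull ((\<lambda>Q. x + sum c Q) ` Pow S)"
    if "\<forall>a\<in>S. 0 \<le> l a \<and> l a \<le> 1" for l
    using assms that
  proof (induction S arbitrary: x)
    case empty
    then show ?case by (simp add: weighted_sum_def)
  next
    case (insert b S)
    let ?H = "convex hull ((\<lambda>Q. x + sum c Q) ` Pow (insert b S))"
    have "(\<lambda>Q. x + sum c Q) ` Pow S \<subseteq> (\<lambda>Q. x + sum c Q) ` Pow (insert b S)"
      by auto
    then have 1: "x + weighted_sum S c l \<in> ?H"
      using insert.IH[of x] insert.prems hull_mono by blast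
    have "(x + c b) + sum c Q = x + sum c (insert b Q)" if "Q \<subseteq> S" for Q
      using that insert.hyps finite_subset[OF that] by (subst sum.insert) auto
    then have "(\<lambda>Q. (x + c b) + sum c Q) ` Pow S \<subseteq> (\<lambda>Q. x + sum c Q) ` Pow (insert b S)"
      by auto
    then have 2: "(x + c b) + weighted_sum S c l \<in> ?H"
      using insert.IH[of "x + c b"] insert.prems hull_mono by blast
    have "(1 - l b) *\<^sub>R (x + weighted_sum S c l) + l b *\<^sub>R ((x + c b) + weighted_sum S c l) \<in> ?H"
      using insert.prems 1 2 by (intro convexD[OF convex_convex_hull]) auto
    moreover have "(1 - l b) *\<^sub>R (x + weighted_sum S c l) + l b *\<^sub>R ((x + c b) + weighted_sum S c l)
        = x + weighted_sum (insert b S) c l"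
      unfolding weighted_sum_def using insert.hyps by (simp add: algebra_simps)
    ultimately show ?case by simp
  qed
  then show "?R \<subseteq> ?L" by blast
qed

lemma face_weights_hull:
  fixes c :: "'b \<Rightarrow> 'v::real_vector"
  assumes "finite A" "I \<subseteq> A" "J \<subseteq> A" "I \<inter> J = {}"
  shows "weighted_sum A c ` face_weights A I J = convex hull (sum c ` {I \<union> Q | Q. Q \<subseteq> A - I - J})"
proof -
  let ?S = "A - I - J"
  have fin: "finite I" "finite J" "finite ?S"
    using assms finite_subset by auto
  have A: "A = (I \<union> J) \<union> ?S" using assms by auto
  have split: "weighted_sum A c l = sum c I + weighted_sum ?S c l" if "l \<in> face_weights A I J" for l
  proof -
    have "weighted_sum A c l = (\<Sum>a\<in>I. l a *\<^sub>R c a) + (\<Sum>a\<in>J. l a *\<^sub>R c a) + weighted_sum ?S c l"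
    proof -
      have "weighted_sum A c l = (\<Sum>a\<in>(I \<union> J) \<union> ?S. l a *\<^sub>R c a)"
        unfolding weighted_sum_def by (simp only: A[symmetric])
      also have "\<dots> = (\<Sum>a\<in>I \<union> J. l a *\<^sub>R c a) + weighted_sum ?S c l"
        unfolding weighted_sum_def using fin by (intro sum.union_disjoint) auto
      also have "(\<Sum>a\<in>I \<union> J. l a *\<^sub>R c a) = (\<Sum>a\<in>I. l a *\<^sub>R c a) + (\<Sum>a\<in>J. l a *\<^sub>R c a)"
        using fin assms by (intro sum.union_disjoint) auto
      finally show ?thesis .
    qed
    then show ?thesis using that by (simp add: face_weights_def)
  qed
  have "sum c (I \<union> Q) = sum c I + sum c Q" if "Q \<subseteq> ?S" for Q
    using that fin finite_subset[OF that] by (intro sum.union_disjoint) auto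
  moreover have "{I \<union> Q | Q. Q \<subseteq> ?S} = (\<lambda>Q. I \<union> Q) ` Pow ?S"
    by blast
  ultimately have "sum c ` {I \<union> Q | Q. Q \<subseteq> ?S} = (\<lambda>Q. sum c I + sum c Q) ` Pow ?S"
    by (simp only: image_image) (intro image_cong refl, simp)
  then have "convex hull (sum c ` {I \<union> Q | Q. Q \<subseteq> ?S})
      = {sum c I + weighted_sum ?S c l | l. \<forall>a\<in>?S. 0 \<le> l a \<and> l a \<le> 1}"
    by (simp only: convex_hull_subset_sums[OF fin(3)])
  also have "\<dots> = weighted_sum A c ` face_weights A I J"
  proof (intro equalityI subsetI)
    fix y assume "y \<in> weighted_sum A c ` face_weights A I J"
    then show "y \<in> {sum c I + weighted_sum ?S c l | l. \<forall>a\<in>?S. 0 \<le> l a \<and> l a \<le> 1}"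
      using split by (auto simp: face_weights_def)
  next
    fix y assume "y \<in> {sum c I + weighted_sum ?S c l | l. \<forall>a\<in>?S. 0 \<le> l a \<and> l a \<le> 1}"
    then obtain l where l: "y = sum c I + weighted_sum ?S c l" "\<forall>a\<in>?S. 0 \<le> l a \<and> l a \<le> 1"
      by blast
    define m where "m a = (if a \<in> I then 1 else if a \<in> J then 0 else l a)" for a
    have m: "m \<in> face_weights A I J"
      unfolding face_weights_def m_def using l assms by auto
    have "weighted_sum ?S c m = weighted_sum ?S c l"
      unfolding weighted_sum_def m_def by (intro sum.cong) auto
    then show "y \<in> weighted_sum A c ` face_weights A I J"
      using split[OF m] l m by (metis imageI)
  qed
  finally show ?thesis by simp
qed

lemma compact_convex_truncated_face:
  fixes c :: "'b \<Rightarrow> 'v::euclidean_space"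
  assumes "finite A" "I \<subseteq> A" "J \<subseteq> A" "I \<inter> J = {}"
  shows "compact (weighted_sum A c ` {l \<in> face_weights A I J. k \<le> sum l A})"
    and "convex (weighted_sum A c ` {l \<in> face_weights A I J. k \<le> sum l A})"
proof -
  \<comment> \<open>The total weight need not be a function of the weighted sum for general
    \<open>c\<close>. Recorded as an extra coordinate, it makes the truncation a half-space cut of a
    polytope, which is then projected.\<close>
  define c' where "c' a = (1 :: real, c a)" for a
  define H where "H = weighted_sum A c' ` face_weights A I J"
  have H: "H = convex hull (sum c' ` {I \<union> Q | Q. Q \<subseteq> A - I - J})"
    unfolding H_def using assms by (rule face_weights_hull)
  have "finite {I \<union> Q | Q. Q \<subseteq> A - I - J}"
    using assms by (intro finite_subset[of "{I \<union> Q | Q. Q \<subseteq> A - I - J}" "Pow A"]) auto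
  then have "compact H" "convex H"
    unfolding H by (auto intro: finite_imp_compact_convex_hull)
  then have K: "compact (H \<inter> {x. k \<le> fst x})" "convex (H \<inter> {x. k \<le> fst x})"
  proof -
    have "closed {x :: real \<times> 'v. k \<le> fst x}"
      by (intro closed_Collect_le continuous_intros)
    then show "compact (H \<inter> {x. k \<le> fst x})"
      using \<open>compact H\<close> by (simp add: compact_Int_closed)
    have "convex {x :: real \<times> 'v. k \<le> fst x}"
      by (auto simp: convex_def) (metis add_mono distrib_right mult_1 mult_left_mono)
    then show "convex (H \<inter> {x. k \<le> fst x})"
      using \<open>convex H\<close> by (simp add: convex_Int)
  qed
  have "weighted_sum A c' l = (sum l A, weighted_sum A c l)" for l
    unfolding weighted_sum_def c'_def by (simp add: prod_eq_iff fst_sum snd_sum)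
  then have "weighted_sum A c ` {l \<in> face_weights A I J. k \<le> sum l A} = snd ` (H \<inter> {x. k \<le> fst x})"
    unfolding H_def by (auto simp: image_iff) force
  then show "compact (weighted_sum A c ` {l \<in> face_weights A I J. k \<le> sum l A})"
    and "convex (weighted_sum A c ` {l \<in> face_weights A I J. k \<le> sum l A})"
    using compact_continuous_image[OF continuous_on_snd[OF continuous_on_id] K(1)]
      convex_linear_image[OF linear_snd K(2)] by simp_all
qed

section \<open>The incidence relation between spheres and rhomboids\<close>

lemma compact_ENR_Union_convex:
  fixes F :: "'i \<Rightarrow> 'b::euclidean_space set"
  assumes "finite I" "\<And>i. i \<in> I \<Longrightarrow> compact (F i)" "\<And>i. i \<in> I \<Longrightarrow> convex (F i)"
  shows "compact (\<Union>i\<in>I. F i)" "ENR (\<Union>i\<in>I. F i)"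
  using assms ENR_finite_Union_convex_closed[of "F ` I"] by (auto intro: compact_imp_closed)

text \<open>\<open>sum l A\<close> is the depth, as the last coordinate of the embedded point is
  \<open>- sum l A\<close>.\<close>

definition admissible_weights :: "'a::euclidean_space set \<Rightarrow> real \<Rightarrow> nat \<Rightarrow> ('a \<Rightarrow> real) set" where
  "admissible_weights A r k =
     {l. (\<exists>p. compatible A p l \<and> sq_radius p \<le> r\<^sup>2) \<and> real k \<le> sum l A}"

definition sliced_rhomb :: "'a::euclidean_space set \<Rightarrow> real \<Rightarrow> nat \<Rightarrow> ('a \<times> real) set" where
  "sliced_rhomb A r k = weight_emb A ` admissible_weights A r k"

definition deep_spheres :: "'a::euclidean_space set \<Rightarrow> real \<Rightarrow> nat \<Rightarrow> ('a \<times> real) set" where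
  "deep_spheres A r k = {p. sq_radius p \<le> r\<^sup>2 \<and> k \<le> card {a \<in> A. 0 \<le> site_height a p}}"

text \<open>The space Z(r, k). A pair keeps only the embedded point, not its weights; two pairs over
  one point may thus come from different weights, which \<open>compatible_exchange\<close>
  reconciles.\<close>

definition incidence :: "'a::euclidean_space set \<Rightarrow> real \<Rightarrow> nat \<Rightarrow> (('a \<times> real) \<times> ('a \<times> real)) set" where
  "incidence A r k = {(p, weight_emb A l) | p l.
     compatible A p l \<and> sq_radius p \<le> r\<^sup>2 \<and> real k \<le> sum l A}"

lemma incidenceI:
  assumes "compatible A p l" "sq_radius p \<le> r\<^sup>2" "real k \<le> sum l A"
  shows "(p, weight_emb A l) \<in> incidence A r k"
  unfolding incidence_def using assms by blast

lemma weighted_sum_admissible_weights: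
  assumes "finite A" "1 \<le> k"
  shows "weighted_sum A c ` admissible_weights A r k =
    (\<Union>(I, J)\<in>{(I, J) \<in> faces A. face_spheres A I J r \<noteq> {}}.
       weighted_sum A c ` {l \<in> face_weights A I J. real k \<le> sum l A})"
proof -
  have "l \<in> admissible_weights A r k \<longleftrightarrow>
    (\<exists>(I, J)\<in>{(I, J) \<in> faces A. face_spheres A I J r \<noteq> {}}. l \<in> face_weights A I J \<and> real k \<le> sum l A)"
    for l
    unfolding admissible_weights_def using compatible_iff_face[OF assms, of l] by blast
  then have "admissible_weights A r k = (\<Union>(I, J)\<in>{(I, J) \<in> faces A. face_spheres A I J r \<noteq> {}}.
       {l \<in> face_weights A I J. real k \<le> sum l A})"
    by auto
  then show ?thesis
    by (simp add: image_UN case_prod_beta)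
qed

lemma compact_ENR_admissible_image:
  fixes c :: "'a::euclidean_space \<Rightarrow> 'v::euclidean_space"
  assumes "finite A" "1 \<le> k"
  shows "compact (weighted_sum A c ` admissible_weights A r k)"
    and "ENR (weighted_sum A c ` admissible_weights A r k)"
proof -
  let ?G = "{(I, J) \<in> faces A. face_spheres A I J r \<noteq> {}}"
  have fin: "finite ?G"
    using finite_faces[OF assms(1)] by (rule finite_subset[rotated]) auto
  have "compact (case i of (I, J) \<Rightarrow> weighted_sum A c ` {l \<in> face_weights A I J. real k \<le> sum l A})"
    "convex (case i of (I, J) \<Rightarrow> weighted_sum A c ` {l \<in> face_weights A I J. real k \<le> sum l A})"
    if "i \<in> ?G" for i
    using that compact_convex_truncated_face[OF assms(1), where c = c and I = "fst i" and J = "snd i"]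
    unfolding faces_def by auto
  from compact_ENR_Union_convex[OF fin this]
  show "compact (weighted_sum A c ` admissible_weights A r k)"
    and "ENR (weighted_sum A c ` admissible_weights A r k)"
    unfolding weighted_sum_admissible_weights[OF assms] by auto
qed

lemma compact_ENR_incidence:
  assumes "finite A" "0 \<le> r" "1 \<le> k"
  shows "compact (incidence A r k)" "ENR (incidence A r k)"
proof -
  define F where "F i = face_spheres A (fst i) (snd i) r \<times>
    (weight_emb A ` {l \<in> face_weights A (fst i) (snd i). real k \<le> sum l A})" for i
  have eq: "incidence A r k = (\<Union>i\<in>faces A. F i)"
  proof (intro equalityI subsetI)
    fix x assume "x \<in> incidence A r k"
    then obtain p l where x: "x = (p, weight_emb A l)" "compatible A p l \<and> sq_radius p \<le> r\<^sup>2" "real k \<le> sum l A"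
      unfolding incidence_def by blast
    then obtain I J where "(I, J) \<in> faces A" "p \<in> face_spheres A I J r" "l \<in> face_weights A I J"
      using compatible_iff_face[OF assms(1,3) x(3), of p] by blast
    then show "x \<in> (\<Union>i\<in>faces A. F i)"
      unfolding F_def using x by force
  next
    fix x assume "x \<in> (\<Union>i\<in>faces A. F i)"
    then obtain I J p l where x: "(I, J) \<in> faces A" "x = (p, weight_emb A l)"
      "p \<in> face_spheres A I J r" "l \<in> face_weights A I J" "real k \<le> sum l A"
      unfolding F_def by auto
    then show "x \<in> incidence A r k"
      unfolding incidence_def using compatible_iff_face[OF assms(1,3) x(5), of p] by blast
  qed
  have "compact (F i)" "convex (F i)" if "i \<in> faces A" for i
  proof -
    have i: "fst i \<subseteq> A" "snd i \<subset> A" "snd i \<subseteq> A" "fst i \<inter> snd i = {}"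
      using that unfolding faces_def by auto
    show "compact (F i)" "convex (F i)"
      unfolding F_def weight_emb_def
      using compact_convex_truncated_face[OF assms(1) i(1,3,4)]
        compact_face_spheres[OF assms(2) i(2)] convex_face_spheres
      by (intro compact_Times convex_Times; blast)+
  qed
  from compact_ENR_Union_convex[OF finite_faces[OF assms(1)] this]
  show "compact (incidence A r k)" "ENR (incidence A r k)"
    unfolding eq by auto
qed

text \<open>Turns a k-fold covering condition into a finite union of intersections, each convex when
  the single conditions are; this serves both \<open>deep_spheres\<close> and
  \<open>Cov\<close>.\<close>

lemma k_subsets_Union:
  assumes "finite A"
  shows "{x. k \<le> card {a \<in> A. P a x}} = (\<Union>Q\<in>{Q. Q \<subseteq> A \<and> card Q = k}. {x. \<forall>a\<in>Q. P a x})"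
proof (intro equalityI subsetI)
  fix x assume "x \<in> {x. k \<le> card {a \<in> A. P a x}}"
  then obtain Q where "Q \<subseteq> {a \<in> A. P a x}" "card Q = k"
    using obtain_subset_with_card_n by blast
  then show "x \<in> (\<Union>Q\<in>{Q. Q \<subseteq> A \<and> card Q = k}. {x. \<forall>a\<in>Q. P a x})" by blast
next
  fix x assume "x \<in> (\<Union>Q\<in>{Q. Q \<subseteq> A \<and> card Q = k}. {x. \<forall>a\<in>Q. P a x})"
  then obtain Q where "Q \<subseteq> A" "card Q = k" "\<forall>a\<in>Q. P a x" by blast
  then show "x \<in> {x. k \<le> card {a \<in> A. P a x}}"
    using assms card_mono[of "{a \<in> A. P a x}" Q] by auto
qed

lemma compact_ENR_deep_spheres:
  assumes "finite A" "0 \<le> r" "1 \<le> k"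
  shows "compact (deep_spheres A r k)" "ENR (deep_spheres A r k)"
proof -
  define F where "F Q = {p. sq_radius p \<le> r\<^sup>2} \<inter> {p. \<forall>a\<in>Q. 0 \<le> site_height a p}" for Q :: "'a set"
  have eq: "deep_spheres A r k = (\<Union>Q\<in>{Q. Q \<subseteq> A \<and> card Q = k}. F Q)"
  proof -
    have "deep_spheres A r k = {p. sq_radius p \<le> r\<^sup>2} \<inter> {p. k \<le> card {a \<in> A. 0 \<le> site_height a p}}"
      unfolding deep_spheres_def by auto
    then show ?thesis
      unfolding k_subsets_Union[OF assms(1)] F_def by simp
  qed
  have "compact (F Q) \<and> convex (F Q)" if Q: "Q \<in> {Q. Q \<subseteq> A \<and> card Q = k}" for Q
  proof -
    have "Q \<noteq> {}" using Q assms by auto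
    then have "F Q = (\<Inter>a\<in>Q. {p. sq_radius p \<le> r\<^sup>2 \<and> 0 \<le> site_height a p})"
      unfolding F_def by auto
    then have "compact (F Q)"
      using \<open>Q \<noteq> {}\<close> compact_spheres_enclosing[OF assms(2)] by (simp only:) (intro compact_Inter, auto)
    moreover have "F Q = {p. sq_radius p \<le> r\<^sup>2} \<inter> (\<Inter>a\<in>Q. {p. 0 \<le> site_height a p})"
      unfolding F_def by auto
    then have "convex (F Q)"
      by (simp add: convex_Int convex_INT convex_sq_radius_le convex_site_height)
    ultimately show ?thesis by blast
  qed
  then show "compact (deep_spheres A r k)" "ENR (deep_spheres A r k)"
    unfolding eq using compact_ENR_Union_convex[of "{Q. Q \<subseteq> A \<and> card Q = k}" F] assms(1) by auto
qed

lemma ENR_Cov: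
  assumes "finite A" "1 \<le> k"
  shows "ENR (Cov A r k)"
proof -
  have "Cov A r k = (\<Union>Q\<in>{Q. Q \<subseteq> A \<and> card Q = k}. {b. \<forall>a\<in>Q. dist b a \<le> r})"
    unfolding Cov_def by (rule k_subsets_Union[OF assms(1)])
  also have "\<dots> = (\<Union>Q\<in>{Q. Q \<subseteq> A \<and> card Q = k}. \<Inter>a\<in>Q. cball a r)"
    by (auto simp: dist_commute)
  finally have eq: "Cov A r k = (\<Union>Q\<in>{Q. Q \<subseteq> A \<and> card Q = k}. \<Inter>a\<in>Q. cball a r)" .
  have "compact (\<Inter>a\<in>Q. cball a r) \<and> convex (\<Inter>a\<in>Q. cball a r)"
    if "Q \<in> {Q. Q \<subseteq> A \<and> card Q = k}" for Q
  proof -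
    have "Q \<noteq> {}" using that assms by auto
    then show ?thesis
      by (intro conjI compact_Inter convex_INT) auto
  qed
  then show ?thesis
    unfolding eq using assms(1) by (intro compact_ENR_Union_convex) auto
qed

section \<open>Images of the projections\<close>

lemma fst_deep_spheres:
  assumes "0 \<le> r" "finite A" "1 \<le> k"
  shows "fst ` deep_spheres A r k = Cov A r k"
proof (intro equalityI subsetI)
  fix b assume "b \<in> fst ` deep_spheres A r k"
  then obtain p where p: "b = fst p" "sq_radius p \<le> r\<^sup>2" "k \<le> card {a \<in> A. 0 \<le> site_height a p}"
    unfolding deep_spheres_def by blast
  have "dist b a \<le> r" if "0 \<le> site_height a p" for a
    using that p(1,2) by (intro power2_le_imp_le[OF _ assms(1)]) (simp add: site_height_eq)
  then have "{a \<in> A. 0 \<le> site_height a p} \<subseteq> {a \<in> A. dist b a \<le> r}"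
    by blast
  then have "card {a \<in> A. 0 \<le> site_height a p} \<le> card {a \<in> A. dist b a \<le> r}"
    using assms(2) by (intro card_mono) auto
  then show "b \<in> Cov A r k"
    unfolding Cov_def using p(3) by simp
next
  fix b assume b: "b \<in> Cov A r k"
  \<comment> \<open>The largest admissible sphere around \<open>b\<close>, of radius exactly
    \<open>r\<close>, encloses the most sites.\<close>
  define p where "p = (b, r\<^sup>2 - b \<bullet> b)"
  have p: "sq_radius p = r\<^sup>2" "fst p = b"
    unfolding p_def sq_radius_def by auto
  then have "{a \<in> A. 0 \<le> site_height a p} = {a \<in> A. dist b a \<le> r}"
    using assms(1) by (auto simp: site_height_eq power2_le_iff_abs_le)
  then show "b \<in> fst ` deep_spheres A r k"
    using b p unfolding Cov_def deep_spheres_def by (intro image_eqI[of _ _ p]) auto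
qed

lemma sum_le_card_support:
  assumes "finite A" "\<And>a. a \<in> A \<Longrightarrow> l a \<le> (1 :: real)" "\<And>a. a \<in> A - B \<Longrightarrow> l a \<le> 0"
  shows "sum l A \<le> card (A \<inter> B)"
proof -
  have "sum l A \<le> (\<Sum>a\<in>A. if a \<in> B then 1 else 0)"
    using assms(2,3) by (intro sum_mono) auto
  also have "\<dots> = card (A \<inter> B)"
    using assms(1) by (simp flip: sum.inter_restrict)
  finally show ?thesis .
qed

lemma fst_incidence:
  assumes "finite A"
  shows "fst ` incidence A r k = deep_spheres A r k"
proof (intro equalityI subsetI)
  fix p assume "p \<in> fst ` incidence A r k"
  then obtain l where l: "compatible A p l" "sq_radius p \<le> r\<^sup>2" "real k \<le> sum l A"
    unfolding incidence_def by auto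
  have "sum l A \<le> card (A \<inter> {a. 0 \<le> site_height a p})"
    using l(1) unfolding compatible_def by (intro sum_le_card_support[OF assms]) auto
  then have "k \<le> card {a \<in> A. 0 \<le> site_height a p}"
    using l(3) by (simp add: Int_def)
  then show "p \<in> deep_spheres A r k"
    unfolding deep_spheres_def using l by auto
next
  fix p assume p: "p \<in> deep_spheres A r k"
  \<comment> \<open>The deepest vertex of the rhomboid: every site inside or on the sphere gets
    weight 1.\<close>
  define l :: "'a \<Rightarrow> real" where "l a = (if 0 \<le> site_height a p then 1 else 0)" for a
  have "sum l A = card {a \<in> A. 0 \<le> site_height a p}"
    unfolding l_def using assms by (simp flip: sum.inter_filter)
  moreover have "compatible A p l"
    unfolding compatible_def l_def by auto
  ultimately have "(p, weight_emb A l) \<in> incidence A r k"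
    using p unfolding deep_spheres_def by (intro incidenceI) auto
  then show "p \<in> fst ` incidence A r k"
    by (rule rev_image_eqI) simp
qed

lemma snd_incidence: "snd ` incidence A r k = sliced_rhomb A r k"
  unfolding incidence_def sliced_rhomb_def admissible_weights_def by force

section \<open>Convexity of the fibres\<close>

lemma weighted_sum_convex_comb:
  "u *\<^sub>R weighted_sum A c l + v *\<^sub>R weighted_sum A c m = weighted_sum A c (\<lambda>a. u * l a + v * m a)"
  unfolding weighted_sum_def
  by (simp add: scaleR_sum_right scaleR_left_distrib sum.distrib)

lemma convex_bound_ge:
  "\<lbrakk>c \<le> x; c \<le> y; 0 \<le> u; 0 \<le> v; u + v = 1\<rbrakk> \<Longrightarrow> c \<le> u * x + v * (y :: real)"
  using convex_bound_le[of "- x" "- c" "- y" u v] by simp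

lemma compatible_convex_comb:
  assumes "compatible A p l" "compatible A p m" "0 \<le> u" "0 \<le> v" "u + v = 1"
  shows "compatible A p (\<lambda>a. u * l a + v * m a)"
  using assms unfolding compatible_def by (auto intro: convex_bound_le)

text \<open>Heights are affine in the sphere, so a strict sign at the combination already occurs at
  \<open>p\<close> or at \<open>q\<close>, whose compatibility then fixes the weight.\<close>

lemma compatible_convex_comb_spheres:
  assumes "compatible A p l" "compatible A q l" "0 \<le> u" "0 \<le> v" "u + v = 1"
  shows "compatible A (u *\<^sub>R p + v *\<^sub>R q) l"
  unfolding compatible_def
proof (intro ballI conjI impI)
  fix a assume a: "a \<in> A"
  show "0 \<le> l a" "l a \<le> 1" using assms a unfolding compatible_def by auto
  let ?h = "site_height a (u *\<^sub>R p + v *\<^sub>R q)"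
  show "l a = 1" if "0 < ?h"
  proof -
    have "0 < site_height a p \<or> 0 < site_height a q"
      using that convex_bound_le[of "site_height a p" 0 "site_height a q" u v] assms(3-5)
      unfolding site_height_convex_comb[OF assms(5)] by fastforce
    then show ?thesis using assms(1,2) a unfolding compatible_def by blast
  qed
  show "l a = 0" if "?h < 0"
  proof -
    have "site_height a p < 0 \<or> site_height a q < 0"
      using that convex_bound_ge[of 0 "site_height a p" "site_height a q" u v] assms(3-5)
      unfolding site_height_convex_comb[OF assms(5)] by fastforce
    then show ?thesis using assms(1,2) a unfolding compatible_def by blast
  qed
qed

lemma weight_emb_eq: "weight_emb A l = (\<Sum>a\<in>A. l a *\<^sub>R a, - sum l A)"
  unfolding weight_emb_def weighted_sum_def
  by (simp add: prod_eq_iff fst_sum snd_sum sum_negf)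

text \<open>The difference of two weights of one point annihilates all affine functions of the site,
  and \<open>site_height a p\<close> is affine in \<open>a\<close> up to the term
  \<open>a \<bullet> a\<close>. The sum therefore does not depend on the sphere.\<close>

lemma sum_diff_site_height:
  assumes "weight_emb A l = weight_emb A m"
  shows "(\<Sum>a\<in>A. (l a - m a) * site_height a p) = - (\<Sum>a\<in>A. (l a - m a) * (a \<bullet> a))"
    and "(\<Sum>a\<in>A. l a - m a) = 0" "(\<Sum>a\<in>A. (l a - m a) *\<^sub>R a) = 0"
proof -
  have eq: "(\<Sum>a\<in>A. l a *\<^sub>R a) = (\<Sum>a\<in>A. m a *\<^sub>R a)" "sum l A = sum m A"
    using assms unfolding weight_emb_eq by simp_all
  then show 1: "(\<Sum>a\<in>A. l a - m a) = 0" and 2: "(\<Sum>a\<in>A. (l a - m a) *\<^sub>R a) = 0"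
    by (simp_all add: sum_subtractf scaleR_left_diff_distrib)
  have "(\<Sum>a\<in>A. (l a - m a) * site_height a p) =
      (\<Sum>a\<in>A. l a - m a) * snd p + 2 * ((\<Sum>a\<in>A. (l a - m a) *\<^sub>R a) \<bullet> fst p)
      - (\<Sum>a\<in>A. (l a - m a) * (a \<bullet> a))"
    unfolding site_height_def
    by (simp add: algebra_simps inner_sum_left sum.distrib sum_subtractf sum_distrib_left)
  then show "(\<Sum>a\<in>A. (l a - m a) * site_height a p) = - (\<Sum>a\<in>A. (l a - m a) * (a \<bullet> a))"
    using 1 2 by simp
qed

text \<open>Complementary slackness: weights representing the same point are compatible with the
  same spheres.\<close>

lemma compatible_exchange:
  assumes "finite A" "compatible A p l" "compatible A q m" "weight_emb A l = weight_emb A m"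
  shows "\<And>a. a \<in> A \<Longrightarrow> (l a - m a) * site_height a p = 0"
    and "compatible A p m"
proof -
  \<comment> \<open>Where the height over \<open>p\<close> is positive, \<open>l\<close> is 1 and so
    at least \<open>m\<close>; where it is negative, \<open>l\<close> is 0. For \<open>q\<close> and
    \<open>m\<close> the signs reverse. As the two sums agree, the sum over \<open>p\<close>
    vanishes, and with it each summand.\<close>
  have nn: "0 \<le> (l a - m a) * site_height a p" "(l a - m a) * site_height a q \<le> 0" if "a \<in> A" for a
    using assms(2,3) that unfolding compatible_def zero_le_mult_iff mult_le_0_iff
    by (smt (verit))+
  have "(\<Sum>a\<in>A. (l a - m a) * site_height a p) = (\<Sum>a\<in>A. (l a - m a) * site_height a q)"
    using sum_diff_site_height(1)[OF assms(4)] by simp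
  moreover have "(\<Sum>a\<in>A. (l a - m a) * site_height a q) \<le> 0"
    using nn by (intro sum_nonpos) auto
  moreover have "0 \<le> (\<Sum>a\<in>A. (l a - m a) * site_height a p)"
    using nn by (intro sum_nonneg) auto
  ultimately have "(\<Sum>a\<in>A. (l a - m a) * site_height a p) = 0" by linarith
  then show 1: "\<And>a. a \<in> A \<Longrightarrow> (l a - m a) * site_height a p = 0"
    using nn assms(1) by (subst (asm) sum_nonneg_eq_0_iff) auto
  show "compatible A p m"
    using assms(2,3) 1 unfolding compatible_def by force
qed

text \<open>Spheres in one fibre are concentric, hence nested: a combination encloses whatever the
  smaller one encloses, so it still encloses k sites, although \<open>deep_spheres\<close> as a
  whole is a union over choices of k sites.\<close>

lemma homotopy_equivalence_deep_spheres_Cov: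
  assumes "finite A" "0 \<le> r" "1 \<le> k"
  shows "homotopy_equivalence_map (top_of_set (deep_spheres A r k)) (Cov_bif A r k) fst"
  unfolding Cov_bif_def fst_deep_spheres[OF assms(2,1,3), symmetric]
proof (rule homotopy_equivalence_map_convex_fibres)
  show "ENR (fst ` deep_spheres A r k)"
    using fst_deep_spheres ENR_Cov assms by metis
  fix x
  show "convex {p \<in> deep_spheres A r k. fst p = x}"
  proof (rule convexI)
    fix p q and u v :: real
    assume p: "p \<in> {p \<in> deep_spheres A r k. fst p = x}" and q: "q \<in> {p \<in> deep_spheres A r k. fst p = x}"
      and uv: "0 \<le> u" "0 \<le> v" "u + v = 1"
    let ?w = "u *\<^sub>R p + v *\<^sub>R q"
    have "fst ?w = x"
      using p q uv by (simp flip: scaleR_left_distrib)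
    have "sq_radius ?w \<le> r\<^sup>2"
      using p q uv convexD[OF convex_sq_radius_le, of p "r\<^sup>2" q u v] unfolding deep_spheres_def by auto
    have *: "k \<le> card {a \<in> A. 0 \<le> site_height a ?w}"
      if "p' \<in> deep_spheres A r k" "\<And>a. site_height a p' \<le> site_height a p \<and> site_height a p' \<le> site_height a q" for p'
    proof -
      have "{a \<in> A. 0 \<le> site_height a p'} \<subseteq> {a \<in> A. 0 \<le> site_height a ?w}"
        using that(2) uv unfolding site_height_convex_comb[OF uv(3)]
        by (auto intro!: add_nonneg_nonneg mult_nonneg_nonneg intro: order_trans)
      then have "card {a \<in> A. 0 \<le> site_height a p'} \<le> card {a \<in> A. 0 \<le> site_height a ?w}"
        using assms(1) by (intro card_mono) auto
      then show ?thesis using that(1) unfolding deep_spheres_def by auto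
    qed
    have "k \<le> card {a \<in> A. 0 \<le> site_height a ?w}"
      using *[of p] *[of q] p q by (cases "snd p \<le> snd q") (auto simp: site_height_def)
    then show "?w \<in> {p \<in> deep_spheres A r k. fst p = x}"
      using \<open>fst ?w = x\<close> \<open>sq_radius ?w \<le> r\<^sup>2\<close> unfolding deep_spheres_def by auto
  qed
qed (use assms compact_ENR_deep_spheres dist_fst_le in auto)

lemma homotopy_equivalence_incidence_deep_spheres:
  assumes "finite A" "0 \<le> r" "1 \<le> k"
  shows "homotopy_equivalence_map (top_of_set (incidence A r k)) (top_of_set (deep_spheres A r k)) fst"
  unfolding fst_incidence[OF assms(1), symmetric]
proof (rule homotopy_equivalence_map_convex_fibres)
  show "ENR (fst ` incidence A r k)"
    using fst_incidence compact_ENR_deep_spheres assms by metis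
  fix p
  show "convex {x \<in> incidence A r k. fst x = p}"
  proof (rule convexI)
    fix x y and u v :: real
    assume "x \<in> {x \<in> incidence A r k. fst x = p}" "y \<in> {x \<in> incidence A r k. fst x = p}"
      and uv: "0 \<le> u" "0 \<le> v" "u + v = 1"
    then obtain l m where lm: "x = (p, weight_emb A l)" "y = (p, weight_emb A m)"
      "compatible A p l" "compatible A p m" "sq_radius p \<le> r\<^sup>2" "real k \<le> sum l A" "real k \<le> sum m A"
      unfolding incidence_def by auto
    let ?n = "\<lambda>a. u * l a + v * m a"
    have "u *\<^sub>R p + v *\<^sub>R p = p"
      using uv by (simp flip: scaleR_left_distrib)
    then have "u *\<^sub>R x + v *\<^sub>R y = (p, weight_emb A ?n)"
      unfolding lm by (simp add: weighted_sum_convex_comb weight_emb_def)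
    moreover have "real k \<le> sum ?n A"
      using lm uv by (simp add: sum.distrib convex_bound_ge flip: sum_distrib_left)
    moreover have "compatible A p ?n"
      using compatible_convex_comb lm uv by blast
    ultimately have "u *\<^sub>R x + v *\<^sub>R y \<in> incidence A r k \<and> fst (u *\<^sub>R x + v *\<^sub>R y) = p"
      using lm(5) incidenceI by simp
    then show "u *\<^sub>R x + v *\<^sub>R y \<in> {x \<in> incidence A r k. fst x = p}"
      by blast
  qed
qed (use assms compact_ENR_incidence dist_fst_le in auto)

lemma homotopy_equivalence_incidence_sliced_rhomb:
  assumes "finite A" "0 \<le> r" "1 \<le> k"
  shows "homotopy_equivalence_map (top_of_set (incidence A r k)) (top_of_set (sliced_rhomb A r k)) snd"
  unfolding snd_incidence[symmetric]
proof (rule homotopy_equivalence_map_convex_fibres)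
  show "ENR (snd ` incidence A r k)"
    using compact_ENR_admissible_image assms
    unfolding snd_incidence sliced_rhomb_def weight_emb_def by blast
  fix w
  show "convex {x \<in> incidence A r k. snd x = w}"
  proof (rule convexI)
    fix x y and u v :: real
    assume x: "x \<in> {x \<in> incidence A r k. snd x = w}" and y: "y \<in> {x \<in> incidence A r k. snd x = w}"
      and uv: "0 \<le> u" "0 \<le> v" "u + v = 1"
    obtain p l where l: "x = (p, weight_emb A l)" "compatible A p l" "sq_radius p \<le> r\<^sup>2" "real k \<le> sum l A"
      using x unfolding incidence_def by blast
    obtain q m where m: "y = (q, weight_emb A m)" "compatible A q m" "sq_radius q \<le> r\<^sup>2"
      using y unfolding incidence_def by blast
    have w: "w = weight_emb A l" "weight_emb A m = weight_emb A l"
      using x y l m by auto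
    have "u *\<^sub>R w + v *\<^sub>R w = w"
      using uv by (simp flip: scaleR_left_distrib)
    then have "u *\<^sub>R x + v *\<^sub>R y = (u *\<^sub>R p + v *\<^sub>R q, weight_emb A l)"
      using l m w by simp
    \<comment> \<open>The second pair came with its own weight \<open>m\<close>; exchanging it lets
      the single weight \<open>l\<close> serve both spheres and hence their combination.\<close>
    moreover have "compatible A q l"
      using compatible_exchange(2)[OF assms(1) m(2) l(2) w(2)] .
    then have "compatible A (u *\<^sub>R p + v *\<^sub>R q) l"
      using compatible_convex_comb_spheres l uv by blast
    moreover have "sq_radius (u *\<^sub>R p + v *\<^sub>R q) \<le> r\<^sup>2"
      using l m uv convexD[OF convex_sq_radius_le, of p "r\<^sup>2" q u v] by auto
    ultimately have "u *\<^sub>R x + v *\<^sub>R y \<in> incidence A r k \<and> snd (u *\<^sub>R x + v *\<^sub>R y) = w"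
      using l(4) w(1) incidenceI by simp
    then show "u *\<^sub>R x + v *\<^sub>R y \<in> {x \<in> incidence A r k. snd x = w}"
      by blast
  qed
qed (use assms compact_ENR_incidence dist_snd_le in auto)

section \<open>General position and saturation\<close>

text \<open>Appending a coordinate 1 makes affine independence linear, so a linear functional can
  take any values on the sites. The form \<open>t + 2 * (a \<bullet> w)\<close> is the rate at which
  \<open>site_height a\<close> changes in direction \<open>(w, t)\<close>.\<close>

lemma affine_independent_interpolation:
  fixes S :: "'a::euclidean_space set"
  assumes "finite S" "\<not> affine_dependent S"
  shows "\<exists>w t. \<forall>a\<in>S. t + 2 * (a \<bullet> w) = \<sigma> a"
proof -
  define B where "B = (\<lambda>a. (a, 1 :: real)) ` S"
  have inj: "inj_on (\<lambda>a. (a, 1 :: real)) S" by (auto intro: inj_onI)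
  have "finite B" unfolding B_def using assms by simp
  have "independent B"
    unfolding independent_explicit
  proof (intro conjI allI impI ballI)
    show "finite B" by fact
    fix c b assume c: "(\<Sum>v\<in>B. c v *\<^sub>R v) = 0" and b: "b \<in> B"
    have "(\<Sum>a\<in>S. c (a, 1) *\<^sub>R (a, 1 :: real)) = 0"
      using c unfolding B_def by (simp add: sum.reindex[OF inj])
    then have "(\<Sum>a\<in>S. c (a, 1) *\<^sub>R a) = 0" "(\<Sum>a\<in>S. c (a, 1)) = 0"
      by (simp_all add: prod_eq_iff fst_sum snd_sum)
    then have "\<forall>a\<in>S. c (a, 1) = 0"
      using assms(2) unfolding affine_dependent_explicit_finite[OF assms(1)] by blast
    then show "c b = 0" using b unfolding B_def by auto
  qed
  then obtain f :: "'a \<times> real \<Rightarrow> real" where f: "linear f" "\<forall>x\<in>B. f x = \<sigma> (fst x)"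
    using linear_independent_extend[of B "\<lambda>x. \<sigma> (fst x)"] by blast
  define v where "v = adjoint f 1"
  have "f x = x \<bullet> v" for x
    unfolding v_def adjoint_works[OF f(1)] by simp
  then have "(a, 1) \<bullet> v = \<sigma> a" if "a \<in> S" for a
    using f(2) that unfolding B_def by force
  then have "snd v + 2 * (a \<bullet> ((1/2) *\<^sub>R fst v)) = \<sigma> a" if "a \<in> S" for a
    using that by (simp add: inner_prod_def add.commute)
  then show ?thesis by blast
qed

text \<open>The bound on cospherical sites makes the set small enough for the clause on affine
  independence. Without a positive squared radius, at most the centre can have height 0.\<close>

lemma general_position_independent:
  fixes A :: "'a::euclidean_space set"
  assumes "finite A" "general_position A"
  shows "\<not> affine_dependent {a \<in> A. site_height a p = 0}"
proof -
  let ?O = "{a \<in> A. site_height a p = 0}"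
  have "card ?O \<le> DIM('a) + 1"
  proof (cases "0 < sq_radius p")
    case True
    have "?O \<subseteq> A \<inter> sphere (fst p) (sqrt (sq_radius p))"
      by (auto simp: site_height_eq real_sqrt_unique)
    then have "card ?O \<le> card (A \<inter> sphere (fst p) (sqrt (sq_radius p)))"
      using assms(1) by (intro card_mono) auto
    also have "\<dots> < DIM('a) + 2"
      using assms(2) True unfolding general_position_def by simp
    finally show ?thesis by simp
  next
    case False
    have "?O \<subseteq> {fst p}"
    proof
      fix a assume "a \<in> ?O"
      then have "(dist (fst p) a)\<^sup>2 \<le> 0" using False by (simp add: site_height_eq)
      then show "a \<in> {fst p}" by simp
    qed
    then have "card ?O \<le> 1" using card_mono[of "{fst p}" ?O] by simp
    then show ?thesis by simp
  qed
  moreover have "?O \<subseteq> A" by simp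
  ultimately show ?thesis
    using assms(2) unfolding general_position_def by meson
qed

text \<open>Off the sphere \<open>p\<close> the exchange argument makes the weights agree; on it
  their difference would be an affine dependence. This is the sense in which rhomboids tile without
  overlap.\<close>

lemma weight_emb_inject:
  assumes "finite A" "general_position A"
    and "compatible A p l" "compatible A q m" "weight_emb A l = weight_emb A m" "a \<in> A"
  shows "l a = m a"
proof -
  let ?O = "{a \<in> A. site_height a p = 0}"
  have off: "l b = m b" if "b \<in> A - ?O" for b
    using compatible_exchange(1)[OF assms(1,3-5), of b] that by auto
  have "(\<Sum>b\<in>?O. l b - m b) = (\<Sum>b\<in>A. l b - m b)"
    "(\<Sum>b\<in>?O. (l b - m b) *\<^sub>R b) = (\<Sum>b\<in>A. (l b - m b) *\<^sub>R b)"
    using assms(1) off by (intro sum.mono_neutral_left; auto)+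
  then have "(\<Sum>b\<in>?O. l b - m b) = 0" "(\<Sum>b\<in>?O. (l b - m b) *\<^sub>R b) = 0"
    using sum_diff_site_height(2,3)[OF assms(5)] by auto
  moreover have "finite ?O" using assms(1) by simp
  ultimately have "\<forall>b\<in>?O. l b - m b = 0"
    using general_position_independent[OF assms(1,2), of p] affine_dependent_explicit_finite by blast
  then show ?thesis using off assms(6) by force
qed

lemma weight_emb_cong:
  "(\<And>a. a \<in> A \<Longrightarrow> l a = m a) \<Longrightarrow> weight_emb A l = weight_emb A m"
  unfolding weight_emb_def weighted_sum_def by (rule sum.cong) auto

text \<open>Only the values on \<open>A\<close> are determined by the point; the choice is arbitrary
  elsewhere, and \<open>weight_emb\<close> ignores those values.\<close>

definition weights_of :: "'a::euclidean_space set \<Rightarrow> 'a \<times> real \<Rightarrow> 'a \<Rightarrow> real" where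
  "weights_of A y = (SOME l. (\<exists>p. compatible A p l) \<and> weight_emb A l = y)"

lemma weights_of_weight_emb:
  assumes "finite A" "general_position A" "compatible A p l" "a \<in> A"
  shows "weights_of A (weight_emb A l) a = l a"
proof -
  have "(\<exists>p. compatible A p (weights_of A (weight_emb A l))) \<and>
      weight_emb A (weights_of A (weight_emb A l)) = weight_emb A l"
    unfolding weights_of_def by (rule someI[of _ l]) (use assms(3) in blast)
  then show ?thesis
    using weight_emb_inject[OF assms(1,2)] assms(3,4) by metis
qed

text \<open>The graph is itself an image of \<open>admissible_weights\<close>, under the embedding
  extended by the coordinate \<open>l a\<close>, and hence compact. A closed graph over a compact
  range gives continuity.\<close>

lemma continuous_on_weights_of:
  assumes "finite A" "general_position A" "1 \<le> k" "a \<in> A"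
  shows "continuous_on (sliced_rhomb A r k) (\<lambda>y. weights_of A y a)"
proof (rule continuous_from_closed_graph)
  show "compact {0..1 :: real}" by simp
  have w: "weights_of A (weight_emb A l) a = l a" if "l \<in> admissible_weights A r k" for l
    using that weights_of_weight_emb assms unfolding admissible_weights_def by blast
  show "(\<lambda>y. weights_of A y a) \<in> sliced_rhomb A r k \<rightarrow> {0..1}"
  proof
    fix y assume "y \<in> sliced_rhomb A r k"
    then obtain l where l: "l \<in> admissible_weights A r k" "y = weight_emb A l"
      unfolding sliced_rhomb_def by blast
    then have "0 \<le> l a \<and> l a \<le> 1"
      using assms(4) unfolding admissible_weights_def compatible_def by blast
    then show "weights_of A y a \<in> {0..1}"
      using l w by simp
  qed
  define c where "c b = ((b, -1 :: real), if b = a then 1 else 0 :: real)" for b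
  have "weighted_sum A c l = (weight_emb A l, l a)" for l
    unfolding weight_emb_eq weighted_sum_def c_def
    using assms(1,4)
    by (simp add: prod_eq_iff fst_sum snd_sum sum_negf if_distrib[of "\<lambda>t. _ * t"] cong: if_cong)
  then have "(\<lambda>y. (y, weights_of A y a)) ` sliced_rhomb A r k = weighted_sum A c ` admissible_weights A r k"
    unfolding sliced_rhomb_def image_image using w by (intro image_cong) auto
  then show "closed ((\<lambda>y. (y, weights_of A y a)) ` sliced_rhomb A r k)"
    using compact_ENR_admissible_image(1)[OF assms(1,3)] by (metis compact_imp_closed)
qed

text \<open>Sites of weight 1 belong to every vertex of the face carrying the point in its relative
  interior; their number is the least depth of that face. \<open>Rhomb_eq_full_weights\<close> draws
  the consequence.\<close>

definition full_weights :: "'a::euclidean_space set \<Rightarrow> real \<Rightarrow> nat \<Rightarrow> ('a \<Rightarrow> real) set" where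
  "full_weights A r k =
     {l. (\<exists>p. compatible A p l \<and> sq_radius p \<le> r\<^sup>2) \<and> k \<le> card {a \<in> A. l a = 1}}"

lemma full_weights_subset:
  assumes "finite A"
  shows "full_weights A r k \<subseteq> admissible_weights A r k"
proof
  fix l assume l: "l \<in> full_weights A r k"
  have "real (card {a \<in> A. l a = 1}) = (\<Sum>a\<in>{a \<in> A. l a = 1}. l a)" by simp
  also have "\<dots> \<le> sum l A"
    using l assms unfolding full_weights_def compatible_def by (intro sum_mono2) auto
  finally show "l \<in> admissible_weights A r k"
    using l unfolding full_weights_def admissible_weights_def by auto
qed

text \<open>Weights whose sum is at least k have k entries above \<open>1 / (card A + 1)\<close>, so scaling
  by \<open>card A + 1\<close> and cutting off at 1 saturates k sites.\<close>

definition saturate :: "'a set \<Rightarrow> ('a \<Rightarrow> real) \<Rightarrow> 'a \<Rightarrow> real" where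
  "saturate A l a = min 1 (real (card A + 1) * l a)"

lemma saturate_bounds:
  assumes "0 \<le> l a" "l a \<le> 1"
  shows "l a \<le> saturate A l a" "saturate A l a \<le> 1" "0 \<le> saturate A l a"
proof -
  have "1 * l a \<le> real (card A + 1) * l a"
    using assms by (intro mult_right_mono) auto
  then show "l a \<le> saturate A l a" using assms unfolding saturate_def by simp
  then show "saturate A l a \<le> 1" "0 \<le> saturate A l a" using assms unfolding saturate_def by auto
qed

lemma compatible_saturate:
  assumes "compatible A p l"
  shows "compatible A p (saturate A l)"
  using assms saturate_bounds[of l _ A] unfolding compatible_def
  by (auto simp: saturate_def intro: order_antisym)

lemma saturate_full:
  assumes "finite A" "l \<in> admissible_weights A r k"
  shows "saturate A l \<in> full_weights A r k"
proof -
  obtain p where p: "compatible A p l" "sq_radius p \<le> r\<^sup>2" and k: "real k \<le> sum l A"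
    using assms(2) unfolding admissible_weights_def by blast
  let ?B = "{a \<in> A. saturate A l a = 1}"
  have "k \<le> card ?B"
  proof (rule ccontr)
    assume "\<not> k \<le> card ?B"
    \<comment> \<open>Unsaturated weights are below \<open>1 / (card A + 1)\<close> and contribute
      less than 1 altogether, saturated ones at most \<open>card ?B\<close>; the total would stay
      below \<open>k\<close>.\<close>
    then have "real (card ?B) + 1 \<le> k" by simp
    moreover have "l a < 1 / real (card A + 1)" if "a \<in> A - ?B" for a
      using that unfolding saturate_def by (auto simp: field_simps min_def split: if_splits)
    then have "sum l (A - ?B) \<le> real (card (A - ?B)) * (1 / real (card A + 1))"
      by (intro sum_bounded_above) (auto intro: less_imp_le)
    moreover have "card (A - ?B) \<le> card A"
      using assms(1) by (intro card_mono) auto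
    then have "real (card (A - ?B)) * (1 / real (card A + 1)) < 1"
      by (simp add: field_simps)
    moreover have "sum l ?B \<le> real (card ?B) * 1"
      using p(1) unfolding compatible_def by (intro sum_bounded_above) auto
    moreover have "sum l A = sum l (A - ?B) + sum l ?B"
      using assms(1) by (intro sum.subset_diff) auto
    ultimately show False using k by linarith
  qed
  then show ?thesis
    unfolding full_weights_def using compatible_saturate[OF p(1)] p(2) by blast
qed

text \<open>Saturation never lowers a weight and keeps the same sphere compatible, so along the
  segment the depth does not fall below its initial value and the radius bound persists.\<close>

lemma admissible_segment:
  assumes "l \<in> admissible_weights A r k" "0 \<le> t" "t \<le> 1"
  shows "(\<lambda>a. (1 - t) * l a + t * saturate A l a) \<in> admissible_weights A r k" (is "?m \<in> _")
proof -
  obtain p where p: "compatible A p l" "sq_radius p \<le> r\<^sup>2" and k: "real k \<le> sum l A"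
    using assms(1) unfolding admissible_weights_def by blast
  have "sum l A \<le> sum ?m A"
  proof (rule sum_mono)
    fix a assume "a \<in> A"
    then have "l a \<le> saturate A l a"
      using p(1) saturate_bounds(1)[of l a A] unfolding compatible_def by simp
    then show "l a \<le> ?m a"
      using convex_bound_ge[of "l a" "l a" "saturate A l a" "1 - t" t] assms(2,3) by simp
  qed
  then have "real k \<le> sum ?m A" using k by linarith
  moreover have "compatible A p ?m"
    using compatible_convex_comb[OF p(1) compatible_saturate[OF p(1)]] assms(2,3) by simp
  ultimately show ?thesis
    unfolding admissible_weights_def using p(2) by blast
qed

text \<open>Saturation fixes the value 1, so sites of weight 1 keep it along the whole
  segment.\<close>

lemma full_segment:
  assumes "finite A" "l \<in> full_weights A r k" "0 \<le> t" "t \<le> 1"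
  shows "(\<lambda>a. (1 - t) * l a + t * saturate A l a) \<in> full_weights A r k" (is "?m \<in> _")
proof -
  obtain p where p: "compatible A p l" "sq_radius p \<le> r\<^sup>2" and k: "k \<le> card {a \<in> A. l a = 1}"
    using assms(2) unfolding full_weights_def by blast
  have "{a \<in> A. l a = 1} \<subseteq> {a \<in> A. ?m a = 1}"
    by (auto simp: saturate_def)
  then have "card {a \<in> A. l a = 1} \<le> card {a \<in> A. ?m a = 1}"
    using assms(1) by (intro card_mono) auto
  moreover have "compatible A p ?m"
    using compatible_convex_comb[OF p(1) compatible_saturate[OF p(1)]] assms(3,4) by simp
  moreover have "k \<le> card {a \<in> A. ?m a = 1}" using k calculation(1) by (rule le_trans)
  ultimately show ?thesis
    unfolding full_weights_def using p(2) by blast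
qed

lemma closed_segment_saturate:
  assumes "u \<in> closed_segment (weight_emb A l) (weight_emb A (saturate A l))"
  obtains t where "0 \<le> t" "t \<le> 1" "u = weight_emb A (\<lambda>a. (1 - t) * l a + t * saturate A l a)"
  using assms unfolding closed_segment_def weight_emb_def weighted_sum_convex_comb by blast

text \<open>Saturation \<open>h\<close> is a homotopy inverse of the inclusion. It need not fix the
  smaller set pointwise, so the straight homotopy to the identity is checked to stay inside each of
  the two sets.\<close>

lemma homotopy_equivalence_full_sliced:
  assumes "finite A" "general_position A" "1 \<le> k"
  shows "homotopy_equivalence_map (top_of_set (weight_emb A ` full_weights A r k))
    (top_of_set (sliced_rhomb A r k)) id"
proof -
  let ?R = "weight_emb A ` full_weights A r k" and ?S = "sliced_rhomb A r k"
  define h where "h y = weight_emb A (saturate A (weights_of A y))" for y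
  have sub: "?R \<subseteq> ?S"
    unfolding sliced_rhomb_def using full_weights_subset[OF assms(1)] by blast
  have h: "h (weight_emb A l) = weight_emb A (saturate A l)" if "l \<in> admissible_weights A r k" for l
  proof -
    have "weights_of A (weight_emb A l) a = l a" if "a \<in> A" for a
      using \<open>l \<in> admissible_weights A r k\<close> weights_of_weight_emb[OF assms(1,2) _ that]
      unfolding admissible_weights_def by blast
    then show ?thesis
      unfolding h_def by (intro weight_emb_cong) (simp add: saturate_def)
  qed
  have cont: "continuous_on ?S h"
    unfolding h_def weight_emb_def weighted_sum_def saturate_def
    by (intro continuous_intros continuous_on_weights_of assms)
  have h_img: "h ` ?S \<subseteq> ?R"
    using h saturate_full[OF assms(1)] unfolding sliced_rhomb_def by auto
  have segS: "closed_segment y (h y) \<subseteq> ?S" if y: "y \<in> ?S" for y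
  proof
    fix u assume u: "u \<in> closed_segment y (h y)"
    obtain l where l: "l \<in> admissible_weights A r k" "y = weight_emb A l"
      using y unfolding sliced_rhomb_def by blast
    then have "u \<in> closed_segment (weight_emb A l) (weight_emb A (saturate A l))"
      using u h by simp
    then obtain t where "0 \<le> t" "t \<le> 1" "u = weight_emb A (\<lambda>a. (1 - t) * l a + t * saturate A l a)"
      by (rule closed_segment_saturate)
    then show "u \<in> ?S"
      using admissible_segment[OF l(1)] unfolding sliced_rhomb_def by simp
  qed
  have segR: "closed_segment y (h y) \<subseteq> ?R" if y: "y \<in> ?R" for y
  proof
    fix u assume u: "u \<in> closed_segment y (h y)"
    obtain l where l: "l \<in> full_weights A r k" "y = weight_emb A l"
      using y by blast
    have "l \<in> admissible_weights A r k" using l full_weights_subset[OF assms(1)] by blast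
    then have "u \<in> closed_segment (weight_emb A l) (weight_emb A (saturate A l))"
      using u h l by simp
    then obtain t where "0 \<le> t" "t \<le> 1" "u = weight_emb A (\<lambda>a. (1 - t) * l a + t * saturate A l a)"
      by (rule closed_segment_saturate)
    then show "u \<in> ?R"
      using full_segment[OF assms(1) l(1)] by simp
  qed
  have "homotopic_with_canon (\<lambda>_. True) ?R ?R id (h \<circ> id)"
    using segR continuous_on_subset[OF cont sub] by (intro homotopic_with_linear) (auto simp: id_def)
  moreover have "homotopic_with_canon (\<lambda>_. True) ?S ?S id (id \<circ> h)"
    using segS cont by (intro homotopic_with_linear) (auto simp: id_def)
  moreover have "continuous_map (top_of_set ?R) (top_of_set ?S) id"
    using sub by auto
  moreover have "continuous_map (top_of_set ?S) (top_of_set ?R) h"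
    using cont h_img by auto
  ultimately show ?thesis
    unfolding homotopy_equivalence_map_def using homotopic_with_symD by blast
qed

section \<open>The rhomboid bifiltration\<close>

lemma vertex_emb_eq_sum: "vertex_emb v = (\<Sum>a\<in>v. (a, -1))"
  unfolding vertex_emb_def by (simp add: prod_eq_iff fst_sum snd_sum)

lemma geom_rhomboid_face:
  assumes "finite A" "I \<subseteq> A" "J \<subseteq> A" "I \<inter> J = {}"
  shows "geom_rhomboid {I \<union> Q | Q. Q \<subseteq> A - I - J} = weight_emb A ` face_weights A I J"
  unfolding geom_rhomboid_def weight_emb_def face_weights_hull[OF assms] vertex_emb_eq_sum ..

lemma k_rho_face:
  assumes "finite I" "finite S"
  shows "k_rho {I \<union> Q | Q. Q \<subseteq> S} = card I"
  unfolding k_rho_def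
proof (rule Min_eqI)
  have eq: "{I \<union> Q | Q. Q \<subseteq> S} = (\<lambda>Q. I \<union> Q) ` Pow S" by blast
  show "finite (card ` {I \<union> Q | Q. Q \<subseteq> S})"
    unfolding eq using assms by simp
  show "card I \<in> card ` {I \<union> Q | Q. Q \<subseteq> S}" by blast
  fix y assume "y \<in> card ` {I \<union> Q | Q. Q \<subseteq> S}"
  then obtain Q where "Q \<subseteq> S" "y = card (I \<union> Q)" by blast
  then show "card I \<le> y"
    using assms finite_subset by (auto intro!: card_mono)
qed

lemma A_on_eq: "A_on A z \<rho> = A - A_in A z \<rho> - {a \<in> A. \<rho> < dist z a}"
  unfolding A_on_def A_in_def by auto

text \<open>The sites inside are the intersection of all vertices, and the sites on the sphere are
  what their union adds.\<close>

lemma comb_rhomboid_eq_iff: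
  "comb_rhomboid A z \<rho> = comb_rhomboid A z' \<rho>' \<longleftrightarrow>
     A_in A z \<rho> = A_in A z' \<rho>' \<and> A_on A z \<rho> = A_on A z' \<rho>'"
proof
  have in_eq: "A_in A z \<rho> = \<Inter>(comb_rhomboid A z \<rho>)" for z \<rho>
    unfolding comb_rhomboid_def by blast
  have on_eq: "A_on A z \<rho> = \<Union>(comb_rhomboid A z \<rho>) - A_in A z \<rho>" for z \<rho>
  proof -
    have "\<Union>(comb_rhomboid A z \<rho>) = A_in A z \<rho> \<union> A_on A z \<rho>"
      unfolding comb_rhomboid_def by blast
    moreover have "A_in A z \<rho> \<inter> A_on A z \<rho> = {}"
      unfolding A_in_def A_on_def by auto
    ultimately show ?thesis by blast
  qed
  assume "comb_rhomboid A z \<rho> = comb_rhomboid A z' \<rho>'"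
  then show "A_in A z \<rho> = A_in A z' \<rho>' \<and> A_on A z \<rho> = A_on A z' \<rho>'"
    using in_eq on_eq by metis
qed (simp add: comb_rhomboid_def)

lemma sphere_point:
  fixes z :: "'a::euclidean_space"
  shows "sq_radius (z, \<rho>\<^sup>2 - z \<bullet> z) = \<rho>\<^sup>2" "site_height a (z, \<rho>\<^sup>2 - z \<bullet> z) = \<rho>\<^sup>2 - (dist z a)\<^sup>2"
  by (simp_all add: site_height_eq sq_radius_def)

lemma sphere_point_face:
  assumes "0 < \<rho>"
  shows "(z, \<rho>\<^sup>2 - z \<bullet> z) \<in> face_spheres A (A_in A z \<rho>) {a \<in> A. \<rho> < dist z a} \<rho>"
  unfolding face_spheres_def A_in_def using assms
  by (auto simp: sphere_point not_less intro: power_mono)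

text \<open>The infimum \<open>r_rho\<close> is attained once the strict conditions are closed up, since the spheres of
  bounded radius enclosing a fixed site form a compact set.\<close>

lemma r_rho_attained:
  assumes "0 < \<rho>" "A_in A z \<rho> \<noteq> {}" "0 \<le> r" "r_rho A (comb_rhomboid A z \<rho>) \<le> r"
  obtains p where "p \<in> face_spheres A (A_in A z \<rho>) {a \<in> A. \<rho> < dist z a} r"
proof -
  define I where "I = A_in A z \<rho>"
  define J where "J = {a \<in> A. \<rho> < dist z a}"
  obtain x where "x \<in> A" "dist z x < \<rho>"
    using assms(2) unfolding A_in_def by blast
  then have "x \<in> A - J" unfolding J_def by simp
  then have "J \<subset> A" unfolding J_def by blast
  \<comment> \<open>Above the infimum there is always a sphere with the same rhomboid and smaller
    radius than \<open>s\<close>; with strict signs relaxed it becomes a point of the closed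
    cell.\<close>
  have approx: "\<exists>p t. p \<in> face_spheres A I J t \<and> 0 < t \<and> t < s \<and> sq_radius p = t\<^sup>2" if "r < s" for s
  proof -
    let ?X = "{\<rho>'. 0 < \<rho>' \<and> (\<exists>z'. comb_rhomboid A z' \<rho>' = comb_rhomboid A z \<rho>)}"
    have "?X \<noteq> {}" using assms(1) by blast
    moreover have "Inf ?X < s" using assms(4) that unfolding r_rho_def by linarith
    ultimately have "\<exists>t\<in>?X. t < s" by (rule cInf_lessD)
    then obtain t z' where t: "0 < t" "t < s" "comb_rhomboid A z' t = comb_rhomboid A z \<rho>" by blast
    then have "A_in A z' t = I" "A_on A z' t = A_on A z \<rho>"
      unfolding comb_rhomboid_eq_iff I_def by auto
    moreover have "{a \<in> A. u < dist y a} = A - A_in A y u - A_on A y u" for y u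
      unfolding A_in_def A_on_def by auto
    ultimately have "{a \<in> A. t < dist z' a} = J"
      unfolding J_def I_def by simp
    then have "(z', t\<^sup>2 - z' \<bullet> z') \<in> face_spheres A I J t"
      using sphere_point_face[OF t(1), of z' A] \<open>A_in A z' t = I\<close> by simp
    then show ?thesis using t sphere_point(1) by metis
  qed
  have mono: "p \<in> face_spheres A I J s" if "p \<in> face_spheres A I J t" "0 < t" "t < s" for p s t
  proof -
    have "t\<^sup>2 \<le> s\<^sup>2" using that by (intro power_mono) auto
    then show ?thesis using that(1) unfolding face_spheres_def by auto
  qed
  \<comment> \<open>Any bound above \<open>r\<close> would do in place of \<open>r + 1\<close>: the
    cell becomes nonempty and stays compact, so \<open>sq_radius\<close> attains its minimum
    there.\<close>
  have "face_spheres A I J (r + 1) \<noteq> {}"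
    using approx[of "r + 1"] mono by force
  moreover have "compact (face_spheres A I J (r + 1))"
    using assms(3) \<open>J \<subset> A\<close> by (intro compact_face_spheres) auto
  ultimately have "\<exists>p\<in>face_spheres A I J (r + 1). \<forall>q\<in>face_spheres A I J (r + 1). sq_radius p \<le> sq_radius q"
    by (intro continuous_attains_inf continuous_on_sq_radius)
  then obtain p where p: "p \<in> face_spheres A I J (r + 1)"
    and min: "\<And>q. q \<in> face_spheres A I J (r + 1) \<Longrightarrow> sq_radius p \<le> sq_radius q"
    by blast
  have "sq_radius p \<le> r\<^sup>2"
  proof (rule ccontr)
    assume "\<not> sq_radius p \<le> r\<^sup>2"
    then have "r < sqrt (sq_radius p)"
      by (intro real_less_rsqrt) simp
    then have "r < min (r + 1) (sqrt (sq_radius p))" by simp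
    then obtain q t where q: "q \<in> face_spheres A I J t" "0 < t" "t < r + 1" "t < sqrt (sq_radius p)" "sq_radius q = t\<^sup>2"
      using approx[of "min (r + 1) (sqrt (sq_radius p))"] by auto
    have "t\<^sup>2 < sq_radius p"
    proof -
      have "t\<^sup>2 < (sqrt (sq_radius p))\<^sup>2"
        using q by (intro power_strict_mono) auto
      moreover have "0 < sq_radius p"
        using \<open>\<not> sq_radius p \<le> r\<^sup>2\<close> zero_le_power2[of r] by linarith
      ultimately show ?thesis by simp
    qed
    then show False using min[OF mono[OF q(1-3)]] q(5) by simp
  qed
  then have "p \<in> face_spheres A I J r"
    using p unfolding face_spheres_def by auto
  then show ?thesis using that unfolding I_def J_def by blast
qed

text \<open>Affine independence of the sites on a sphere allows moving each of them inside or outside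
  independently of the others.\<close>

lemma perturbed_sphere:
  fixes A :: "'a::euclidean_space set"
  assumes "finite A" "general_position A" "compatible A p l" "sq_radius p \<le> r\<^sup>2"
    and "0 \<le> r" "r < s" "{a \<in> A. l a = 1} \<noteq> {}"
  shows "\<exists>z \<rho>. 0 < \<rho> \<and> \<rho> < s \<and> A_in A z \<rho> = {a \<in> A. l a = 1} \<and>
    {a \<in> A. \<rho> < dist z a} = {a \<in> A. l a = 0}"
proof -
  \<comment> \<open>Prescribed drift of the sites on the sphere: weight 1 moves inside, weight 0
    outside, and fractional weights stay on it.\<close>
  define \<sigma> :: "'a \<Rightarrow> real" where "\<sigma> a = (if l a = 1 then 1 else if l a = 0 then -1 else 0)" for a
  have "finite {a \<in> A. site_height a p = 0}" using assms(1) by simp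
  then obtain w t where "\<forall>a\<in>{a \<in> A. site_height a p = 0}. t + 2 * (a \<bullet> w) = \<sigma> a"
    using affine_independent_interpolation[OF _ general_position_independent[OF assms(1,2)]] by blast
  then have wt: "t + 2 * (a \<bullet> w) = \<sigma> a" if "a \<in> A" "site_height a p = 0" for a
    using that by simp
  define q where "q \<epsilon> = p + \<epsilon> *\<^sub>R (w, t)" for \<epsilon> :: real
  have h: "site_height a (q \<epsilon>) = site_height a p + \<epsilon> * (t + 2 * (a \<bullet> w))" for a \<epsilon>
    unfolding q_def site_height_add_scale by simp
  have lim: "((\<lambda>\<epsilon>. site_height a (q \<epsilon>)) \<longlongrightarrow> site_height a p) (at_right 0)" for a
    unfolding h by (rule tendsto_eq_intros refl)+ simp
  have "((\<lambda>\<epsilon>. sq_radius (q \<epsilon>)) \<longlongrightarrow> sq_radius p) (at_right 0)"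
    unfolding q_def sq_radius_def by (rule tendsto_eq_intros refl)+ simp
  moreover have "sq_radius p < s\<^sup>2"
    using assms(4-6) power_strict_mono[of r s 2] by simp
  ultimately have "\<forall>\<^sub>F \<epsilon> in at_right 0. sq_radius (q \<epsilon>) < s\<^sup>2"
    by (rule order_tendstoD)
  moreover have "\<forall>\<^sub>F \<epsilon> in at_right 0. 0 < site_height a p \<longrightarrow> 0 < site_height a (q \<epsilon>)" for a
    using order_tendstoD(1)[OF lim, of 0 a] by (cases "0 < site_height a p") simp_all
  then have "\<forall>\<^sub>F \<epsilon> in at_right 0. \<forall>a\<in>A. 0 < site_height a p \<longrightarrow> 0 < site_height a (q \<epsilon>)"
    using assms(1) by (intro eventually_ball_finite ballI)
  moreover have "\<forall>\<^sub>F \<epsilon> in at_right 0. site_height a p < 0 \<longrightarrow> site_height a (q \<epsilon>) < 0" for a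
    using order_tendstoD(2)[OF lim, of a 0] by (cases "site_height a p < 0") simp_all
  then have "\<forall>\<^sub>F \<epsilon> in at_right 0. \<forall>a\<in>A. site_height a p < 0 \<longrightarrow> site_height a (q \<epsilon>) < 0"
    using assms(1) by (intro eventually_ball_finite ballI)
  moreover have "\<forall>\<^sub>F \<epsilon> in at_right 0. (0 :: real) < \<epsilon>"
    by (rule eventually_at_right_less)
  ultimately have "\<forall>\<^sub>F \<epsilon> in at_right 0. 0 < \<epsilon> \<and> sq_radius (q \<epsilon>) < s\<^sup>2 \<and>
      (\<forall>a\<in>A. 0 < site_height a p \<longrightarrow> 0 < site_height a (q \<epsilon>)) \<and>
      (\<forall>a\<in>A. site_height a p < 0 \<longrightarrow> site_height a (q \<epsilon>) < 0)"
    by eventually_elim blast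
  then obtain \<epsilon> where \<epsilon>: "0 < \<epsilon>" "sq_radius (q \<epsilon>) < s\<^sup>2"
      "\<And>a. a \<in> A \<Longrightarrow> 0 < site_height a p \<Longrightarrow> 0 < site_height a (q \<epsilon>)"
      "\<And>a. a \<in> A \<Longrightarrow> site_height a p < 0 \<Longrightarrow> site_height a (q \<epsilon>) < 0"
    using eventually_happens'[OF trivial_limit_at_right_real] by blast
  have sign: "(0 < site_height a (q \<epsilon>) \<longleftrightarrow> l a = 1) \<and> (site_height a (q \<epsilon>) < 0 \<longleftrightarrow> l a = 0)"
    if a: "a \<in> A" for a
  proof (cases "site_height a p" "0 :: real" rule: linorder_cases)
    case less
    then have "l a = 0" using assms(3) a unfolding compatible_def by blast
    then show ?thesis using \<epsilon>(4)[OF a less] by simp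
  next
    case greater
    then have "l a = 1" using assms(3) a unfolding compatible_def by blast
    then show ?thesis using \<epsilon>(3)[OF a greater] by simp
  next
    case equal
    then have "site_height a (q \<epsilon>) = \<epsilon> * \<sigma> a" using h wt[OF a equal] by simp
    then show ?thesis using \<epsilon>(1) unfolding \<sigma>_def by (auto simp: zero_less_mult_iff mult_less_0_iff)
  qed
  define z where "z = fst (q \<epsilon>)"
  define \<rho> where "\<rho> = sqrt (sq_radius (q \<epsilon>))"
  \<comment> \<open>A site of weight 1 is strictly inside after the perturbation, so the squared
    radius is positive and the perturbed point is a genuine sphere.\<close>
  obtain b where "b \<in> A" "l b = 1" using assms(7) by blast
  then have "(dist z b)\<^sup>2 < sq_radius (q \<epsilon>)"
    using sign[of b] unfolding z_def site_height_eq by simp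
  then have pos: "0 < sq_radius (q \<epsilon>)"
    using zero_le_power2 le_less_trans by blast
  then have \<rho>: "0 < \<rho>" "\<rho>\<^sup>2 = sq_radius (q \<epsilon>)"
    unfolding \<rho>_def by auto
  have "\<rho> < s"
    using \<epsilon>(2) assms(5,6) unfolding \<rho>_def by (intro real_less_lsqrt) auto
  have iff: "dist z a < \<rho> \<longleftrightarrow> 0 < site_height a (q \<epsilon>)" "\<rho> < dist z a \<longleftrightarrow> site_height a (q \<epsilon>) < 0" for a
  proof -
    have "dist z a < \<rho> \<longleftrightarrow> (dist z a)\<^sup>2 < \<rho>\<^sup>2"
      using \<rho>(1) power_strict_mono[of "dist z a" \<rho> 2] power2_less_imp_less[of "dist z a" \<rho>] by auto
    then show "dist z a < \<rho> \<longleftrightarrow> 0 < site_height a (q \<epsilon>)"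
      unfolding \<rho>(2) site_height_eq z_def by simp
    have "\<rho> < dist z a \<longleftrightarrow> \<rho>\<^sup>2 < (dist z a)\<^sup>2"
      using \<rho>(1) power_strict_mono[of \<rho> "dist z a" 2] power2_less_imp_less[of \<rho> "dist z a"] by auto
    then show "\<rho> < dist z a \<longleftrightarrow> site_height a (q \<epsilon>) < 0"
      unfolding \<rho>(2) site_height_eq z_def by simp
  qed
  show ?thesis
  proof (intro exI conjI)
    show "0 < \<rho>" "\<rho> < s" by fact+
    show "A_in A z \<rho> = {a \<in> A. l a = 1}"
      unfolding A_in_def iff using sign by blast
    show "{a \<in> A. \<rho> < dist z a} = {a \<in> A. l a = 0}"
      unfolding iff using sign by blast
  qed
qed

text \<open>In one direction the infimal radius is attained in the closed cell, which supplies a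
  compatible sphere of radius at most \<open>r\<close>. In the other, the perturbed spheres have
  exactly the face of \<open>l\<close> as rhomboid and radii below every \<open>s > r\<close>, so
  the infimum is at most \<open>r\<close>. The least depth is \<open>card I\<close> in both
  cases.\<close>

lemma Rhomb_eq_full_weights:
  fixes A :: "'a::euclidean_space set"
  assumes "finite A" "general_position A" "0 \<le> r" "1 \<le> k"
  shows "Rhomb A r k = weight_emb A ` full_weights A r k"
proof (intro equalityI subsetI)
  fix y assume "y \<in> Rhomb A r k"
  then obtain z \<rho> where z: "0 < \<rho>" and y: "y \<in> geom_rhomboid (comb_rhomboid A z \<rho>)"
    and r: "r_rho A (comb_rhomboid A z \<rho>) \<le> r" and k: "k \<le> k_rho (comb_rhomboid A z \<rho>)"
    unfolding Rhomb_def comb_rhomboids_def by blast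
  let ?I = "A_in A z \<rho>" and ?J = "{a \<in> A. \<rho> < dist z a}"
  have sub: "?I \<subseteq> A" "?J \<subseteq> A" "?I \<inter> ?J = {}"
    unfolding A_in_def by auto
  have R: "comb_rhomboid A z \<rho> = {?I \<union> Q | Q. Q \<subseteq> A - ?I - ?J}"
    unfolding comb_rhomboid_def A_on_eq ..
  have "k_rho (comb_rhomboid A z \<rho>) = card ?I"
    unfolding R using assms(1) sub finite_subset by (intro k_rho_face) auto
  then have I: "k \<le> card ?I" using k by simp
  then have "?I \<noteq> {}" using assms(4) by auto
  then obtain p where p: "p \<in> face_spheres A ?I ?J r"
    using r_rho_attained[OF z _ assms(3) r] by blast
  obtain l where l: "y = weight_emb A l" "l \<in> face_weights A ?I ?J"
    using y unfolding R geom_rhomboid_face[OF assms(1) sub] by blast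
  have "?I \<subseteq> {a \<in> A. l a = 1}"
    using l(2) sub unfolding face_weights_def by auto
  then have "card ?I \<le> card {a \<in> A. l a = 1}"
    using assms(1) by (intro card_mono) auto
  then have "k \<le> card {a \<in> A. l a = 1}" using I by simp
  moreover have "compatible A p l" "sq_radius p \<le> r\<^sup>2"
    using compatible_face[OF p l(2)] p unfolding face_spheres_def by auto
  ultimately show "y \<in> weight_emb A ` full_weights A r k"
    using l(1) unfolding full_weights_def by blast
next
  fix y assume "y \<in> weight_emb A ` full_weights A r k"
  then obtain l p where y: "y = weight_emb A l" and p: "compatible A p l" "sq_radius p \<le> r\<^sup>2"
    and k: "k \<le> card {a \<in> A. l a = 1}"
    unfolding full_weights_def by blast
  define I where "I = {a \<in> A. l a = 1}"
  define J where "J = {a \<in> A. l a = 0}"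
  define R where "R = {I \<union> Q | Q. Q \<subseteq> A - I - J}"
  have sub: "I \<subseteq> A" "J \<subseteq> A" "I \<inter> J = {}"
    unfolding I_def J_def by auto
  have "0 < card I" using k assms(4) unfolding I_def by linarith
  then have "I \<noteq> {}" by auto
  have sph: "\<exists>z \<rho>. 0 < \<rho> \<and> \<rho> < s \<and> comb_rhomboid A z \<rho> = R" if s: "r < s" for s
  proof -
    obtain z \<rho> where z: "0 < \<rho>" "\<rho> < s" "A_in A z \<rho> = I" "{a \<in> A. \<rho> < dist z a} = J"
      using perturbed_sphere[OF assms(1,2) p assms(3) s] \<open>I \<noteq> {}\<close> unfolding I_def J_def by blast
    then have "comb_rhomboid A z \<rho> = R"
      unfolding comb_rhomboid_def A_on_eq R_def by simp
    then show ?thesis using z by blast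
  qed
  have "r_rho A R \<le> r"
  proof (rule field_le_epsilon)
    fix e :: real assume "0 < e"
    then obtain z \<rho> where z: "0 < \<rho>" "\<rho> < r + e" "comb_rhomboid A z \<rho> = R"
      using sph[of "r + e"] by auto
    then have "r_rho A R \<le> \<rho>"
      unfolding r_rho_def by (intro cInf_lower bdd_belowI[of _ 0]) auto
    then show "r_rho A R \<le> r + e" using z by simp
  qed
  moreover have "R \<in> comb_rhomboids A"
    using sph[of "r + 1"] unfolding comb_rhomboids_def by auto
  moreover have "k_rho R = card I"
    unfolding R_def using assms(1) sub finite_subset by (intro k_rho_face) auto
  then have "k \<le> k_rho R" using k unfolding I_def by simp
  moreover have "y \<in> geom_rhomboid R"
    unfolding R_def geom_rhomboid_face[OF assms(1) sub] y
    using compatible_imp_face(2)[OF p] unfolding I_def J_def by blast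
  ultimately show "y \<in> Rhomb A r k"
    unfolding Rhomb_def by blast
qed

lemma admissible_deep_incidence_mono:
  assumes "0 \<le> r" "r \<le> r'" "k' \<le> k"
  shows "admissible_weights A r k \<subseteq> admissible_weights A r' k'"
    and "deep_spheres A r k \<subseteq> deep_spheres A r' k'"
    and "incidence A r k \<subseteq> incidence A r' k'"
proof -
  have "r\<^sup>2 \<le> r'\<^sup>2" using assms by (intro power_mono) auto
  then have r: "sq_radius p \<le> r'\<^sup>2" if "sq_radius p \<le> r\<^sup>2" for p :: "'a \<times> real"
    using that by simp
  have k: "real k' \<le> x" if "real k \<le> x" for x using that assms(3) by linarith
  show "admissible_weights A r k \<subseteq> admissible_weights A r' k'"
    unfolding admissible_weights_def using r k by blast
  show "deep_spheres A r k \<subseteq> deep_spheres A r' k'"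
    unfolding deep_spheres_def using r assms(3) le_trans by blast
  show "incidence A r k \<subseteq> incidence A r' k'"
    unfolding incidence_def using r k by blast
qed

theorem theorem11:
  fixes A :: "'a::euclidean_space set"
  assumes "finite A" and "general_position A"
  shows "weakly_equivalent (Cov_bif A) (Rhomb_bif A)"
proof -
  \<comment> \<open>Up to coding, the arrows run Cov <- D <- I -> S <- Rhomb: two projections
    \<open>fst\<close>, one \<open>snd\<close> and an inclusion, each given by the same map at all
    indices.\<close>
  let ?D = "\<lambda>r k. coded_space (deep_spheres A r k)"
  let ?I = "\<lambda>r k. coded_space (incidence A r k)"
  let ?S = "\<lambda>r k. coded_space (sliced_rhomb A r k)"
  have "is_bifiltration ?D"
    by (rule is_bifiltration_coded_space, rule admissible_deep_incidence_mono(2))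
  moreover have "is_bifiltration ?I"
    by (rule is_bifiltration_coded_space, rule admissible_deep_incidence_mono(3))
  moreover have "is_bifiltration ?S"
    unfolding sliced_rhomb_def
    by (rule is_bifiltration_coded_space, rule image_mono, rule admissible_deep_incidence_mono(1))
  ultimately have bif: "is_bifiltration ?D" "is_bifiltration ?I" "is_bifiltration ?S"
    by blast+
  have Cov: "Cov_bif A = (\<lambda>r k. top_of_set (Cov A r k))"
    by (rule ext, rule ext) (rule Cov_bif_def)
  have Rhomb: "Rhomb_bif A = (\<lambda>r k. top_of_set (Rhomb A r k))"
    by (rule ext, rule ext) (rule Rhomb_bif_def)
  have "is_bifiltration (Cov_bif A)"
    unfolding Cov
  proof (rule is_bifiltration_top_of_set)
    fix r r' :: real and k k' :: nat assume le: "r \<le> r'" "k' \<le> k"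
    have "card {a \<in> A. dist b a \<le> r} \<le> card {a \<in> A. dist b a \<le> r'}" for b
      using assms(1) le by (intro card_mono) auto
    then show "Cov A r k \<subseteq> Cov A r' k'"
      unfolding Cov_def using le by (auto intro: order_trans)
  qed
  moreover have "is_bifiltration (Rhomb_bif A)"
    unfolding Rhomb
  proof (rule is_bifiltration_top_of_set)
    fix r r' :: real and k k' :: nat assume "r \<le> r'" "k' \<le> k"
    then show "Rhomb A r k \<subseteq> Rhomb A r' k'"
      unfolding Rhomb_def by (intro Union_mono) force
  qed
  moreover have "he_linked (\<lambda>r k. top_of_set (deep_spheres A r k)) (Cov_bif A)"
    unfolding he_linked_def objectwise_he_morphism_def
    using homotopy_equivalence_deep_spheres_Cov[OF assms(1)]
    by (intro disjI1 exI[of _ "\<lambda>r k. fst"]) auto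
  then have "he_linked (Cov_bif A) ?D"
    by (rule he_linked_sym[OF he_linked_coded_space])
  moreover have "he_linked (\<lambda>r k. top_of_set (incidence A r k)) (\<lambda>r k. top_of_set (deep_spheres A r k))"
    unfolding he_linked_def objectwise_he_morphism_def
    using homotopy_equivalence_incidence_deep_spheres[OF assms(1)]
    by (intro disjI1 exI[of _ "\<lambda>r k. fst"]) auto
  then have "he_linked ?D ?I"
    by (rule he_linked_coded_space[OF he_linked_sym[OF he_linked_coded_space]])
  moreover have "he_linked (\<lambda>r k. top_of_set (incidence A r k)) (\<lambda>r k. top_of_set (sliced_rhomb A r k))"
    unfolding he_linked_def objectwise_he_morphism_def
    using homotopy_equivalence_incidence_sliced_rhomb[OF assms(1)]
    by (intro disjI1 exI[of _ "\<lambda>r k. snd"]) auto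
  then have "he_linked ?I ?S"
    by (rule he_linked_sym[OF he_linked_coded_space[OF he_linked_sym[OF he_linked_coded_space]]])
  moreover have "he_linked (Rhomb_bif A) (\<lambda>r k. top_of_set (sliced_rhomb A r k))"
    unfolding he_linked_def objectwise_he_morphism_def Rhomb
    using homotopy_equivalence_full_sliced[OF assms] Rhomb_eq_full_weights[OF assms]
    by (intro disjI1 exI[of _ "\<lambda>r k. id"]) auto
  then have "he_linked ?S (Rhomb_bif A)"
    by (rule he_linked_coded_space[OF he_linked_sym])
  ultimately show ?thesis
    unfolding weakly_equivalent_def using bif
    by (intro conjI disjI2 exI[of _ "[?D, ?I, ?S]"]) (auto simp: less_Suc_eq nth_Cons')
qed

end
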